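(* Let $\mathcal{P}(X,U)$ be a system of $n$ linear differential polynomial parametric equations $x_i=P_i(U)$, $i=1,\dots,n$, in $n-1$ differential parameters $U=\{u_1,\dots,u_{n-1}\}$ with coefficients in $\mathbb{K}$, with implicit ideal $\mathrm{ID}$ and associated differential polynomials $F_1,\dots,F_n$ and $H_1,\dots,H_n$. If the differential homogeneous resultant $\partial\mathrm{Res}^h(H_1,\dots,H_n)$ is nonzero, then $\mathrm{ID}$ has dimension $n-1$ and $$\partial\mathrm{Res}(F_1,\dots,F_n)(X)=0$$ is the implicit equation of $\mathcal{P}(X,U)$; that is, $\partial\mathrm{Res}(F_1,\dots,F_n)\in\mathbb{K}\{X\}$ is a characteristic polynomial of $\mathrm{ID}$.
   Context: Setting. $\mathbb{K}$ is an ordinary differential field with derivation $\partial$, $n\ge 2$, $X=\{x_1,\dots,x_n\}$ and $U=\{u_1,\dots,u_{n-1}\}$ are sets of differential indeterminates over $\mathbb{K}$; $x_{ik}=\partial^k x_i$, $u_{jk}=\partial^k u_j$. $\mathbb{K}\{X\}$, $\mathbb{K}\{U\}$ are the rings of differential polynomials and $\mathbb{K}[\partial]$ is the ring of linear differential operators. A system of linear DPPEs $\mathcal{P}(X,U)$ is $x_i=P_i(U)$, $i=1,\dots,n$, with $P_i\in\mathbb{K}\{U\}$ of degree at most $1$, not all in $\mathbb{K}$. Write $P_i=a_i-\sum_{j=1}^{n-1}\mathcal{L}_{ij}(u_j)$ with $a_i\in\mathbb{K}$, $\mathcal{L}_{ij}\in\mathbb{K}[\partial]$. Put $H_i(U)=\sum_j\mathcal{L}_{ij}(u_j)$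 and $F_i(X,U)=x_i-a_i+H_i(U)$. Standing assumption: for each $j$ there is $i$ with $\mathcal{L}_{ij}\ne0$. $o_i\ge 0$ is the order of $F_i$ (equal to the highest order of a derivative of some $u_j$ occurring in $H_i$ if $H_i\neq0$, and $0$ if $H_i=0$), and $N=\sum_{i=1}^n o_i$. Implicit ideal and equation. $\mathrm{ID}=\{f\in\mathbb{K}\{X\}: f(P_1(U),\dots,P_n(U))=0\}$, a prime differential ideal; its (differential) dimension is $n-|\mathcal{C}|$ where $\mathcal{C}$ is a characteristic set of $\mathrm{ID}$ (in the sense of Ritt–Kolchin). If the dimension is $n-1$, then $\mathcal{C}=\{A\}$ with $A$ an irreducible differential polynomial, called a characteristic polynomial of $\mathrm{ID}$ (unique up to a nonzero factor in $\mathbb{K}$), and $A(X)=0$ is called the implicit equation of the system. Differential resultants. Order the derivatives by $u_{jk}<u_{j'k'}$ iff $k<k'$, or $k=k'$ and $j<j'$. Let $L=\sum_{i=1}^n(N-o_i+1)=(n-1)N+n$. $M(L)$ is the $L\times L$ matrix over $\mathbb{K}\{X\}$ whose rows are the coefficients of the polynomials $\partial^{N-o_i}F_i,\dots,\partial F_i,F_i$ (in this order, for $i=1$, then $i=2$, ..., $i=n$), viewed as polynomials of degree at most one in the $L-1$ variables $\{u_{jk}: 1\le j\le n-1,\ 0\le k\le N\}$ with coefficients in $\mathbb{K}\{X\}$; columns are indexed by these variables in decreasing order, followed by a last column holding the terms free of $U$. Then $\partial\mathrm{Res}(F_1,\dots,F_n)=\det M(L)$. Let $L^h=L-n=(n-1)N$.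 $M(L^h)$ is the $L^h\times L^h$ matrix over $\mathbb{K}$ whose rows are the coefficients of $\partial^{N-o_i-1}H_i,\dots,\partial H_i,H_i$ (for $i=1,\dots,n$; no rows for $i$ if $N=o_i$) in the variables $\{u_{jk}:1\le j\le n-1,\ 0\le k\le N-1\}$ taken in decreasing order. Then $\partial\mathrm{Res}^h(H_1,\dots,H_n)=\det M(L^h)$.
   Formalization: For n ≥ 3 the formal theorem also assumes N ≥ 1: if N = 0 the matrix of ∂Res^h is empty (determinant 1) and the claim fails, e.g. n = 3, H_1 = H_2 = u_1+u_2, H_3 = 0 gives ∂Res(F_1,F_2,F_3) = 0. *)

theory Defs
  imports
    "HOL-Library.Poly_Mapping"
    "HOL-Computational_Algebra.Polynomial"
    "HOL-Computational_Algebra.Factorial_Ring"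
    "Jordan_Normal_Form.Determinant"
begin

text \<open>
  The pair \<open>(i, k)\<close> stands for the \<open>k\<close>-th derivative of the \<open>i\<close>-th differential indeterminate;
  indeterminates are numbered from 1.  Elements of \<open>'a dpoly\<close> are polynomials in all these
  derivatives.  Both K{X} (indices in \<open>{1..n}\<close>) and K{U} (indices in \<open>{1..n-1}\<close>) are carried by
  \<open>'a dpoly\<close>, and K{X}{U} is carried by \<open>'a dpoly dpoly\<close>: polynomials in the derivatives of U
  with coefficients in K{X}.
\<close>

type_synonym dvar = "nat \<times> nat"
type_synonym dmon = "dvar \<Rightarrow>\<^sub>0 nat"
type_synonym 'a dpoly = "dmon \<Rightarrow>\<^sub>0 'a"

definition derivation :: "('a::comm_ring_1 \<Rightarrow> 'a) \<Rightarrow> bool" where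
  "derivation d \<longleftrightarrow> (\<forall>a b. d (a + b) = d a + d b) \<and> (\<forall>a b. d (a * b) = d a * b + a * d b)"

definition dnext :: "dvar \<Rightarrow> dvar" where
  "dnext v = (fst v, Suc (snd v))"

definition dconst :: "'a::zero \<Rightarrow> 'a dpoly" where
  "dconst c = Poly_Mapping.single 0 c"

definition vmon :: "dvar \<Rightarrow> dmon" where
  "vmon v = Poly_Mapping.single v 1"

definition dvariable :: "dvar \<Rightarrow> 'a::zero_neq_one dpoly" where
  "dvariable v = Poly_Mapping.single (vmon v) 1"

definition dvars :: "'a::zero dpoly \<Rightarrow> dvar set" where
  "dvars p = (\<Union>m\<in>Poly_Mapping.keys p. Poly_Mapping.keys m)"

definition dring :: "nat set \<Rightarrow> 'a::zero dpoly set" where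
  "dring J = {p. dvars p \<subseteq> J \<times> UNIV}"

definition total_degree_le :: "nat \<Rightarrow> 'a::zero dpoly \<Rightarrow> bool" where
  "total_degree_le e p \<longleftrightarrow>
     (\<forall>m\<in>Poly_Mapping.keys p. (\<Sum>v\<in>Poly_Mapping.keys m. Poly_Mapping.lookup m v) \<le> e)"

text \<open>
  The extension of a derivation \<open>d\<close> of the coefficient ring with \<open>(i, k) \<mapsto> (i, Suc k)\<close>: each
  term \<open>c * m\<close> goes to \<open>d c * m\<close> plus the sum over the variables \<open>v\<close> of \<open>m\<close>, with exponent
  \<open>e\<close>, of \<open>e * c * (m / v) * v'\<close>.  The derivation of K{X}{U} is \<open>dderiv (dderiv d)\<close>.
\<close>

definition dderiv :: "('a::comm_ring_1 \<Rightarrow> 'a) \<Rightarrow> 'a dpoly \<Rightarrow> 'a dpoly" where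
  "dderiv d p = (\<Sum>m\<in>Poly_Mapping.keys p.
     Poly_Mapping.single m (d (Poly_Mapping.lookup p m)) +
     (\<Sum>v\<in>Poly_Mapping.keys m.
        Poly_Mapping.single (m - vmon v + vmon (dnext v))
          (of_nat (Poly_Mapping.lookup m v) * Poly_Mapping.lookup p m)))"

text \<open>Substitution of \<open>P i\<close>, together with its derivatives, for the \<open>i\<close>-th indeterminate.\<close>

definition dsubst :: "('a::comm_ring_1 \<Rightarrow> 'a) \<Rightarrow> (nat \<Rightarrow> 'a dpoly) \<Rightarrow> 'a dpoly \<Rightarrow> 'a dpoly" where
  "dsubst d P f = (\<Sum>m\<in>Poly_Mapping.keys f.
     dconst (Poly_Mapping.lookup f m) *
     (\<Prod>v\<in>Poly_Mapping.keys m.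
        ((dderiv d ^^ snd v) (P (fst v))) ^ Poly_Mapping.lookup m v))"

text \<open>
  A linear differential operator, the sum of the \<open>c\<^sub>k \<partial>\<^sup>k\<close> with coefficients written on the left,
  is represented by the coefficient sequence of an \<open>'a poly\<close>.  Only the additive structure of
  \<open>'a poly\<close> is meaningful here: its (commutative) product is not the product of operators.
\<close>

definition dop_apply :: "('a::comm_ring_1 \<Rightarrow> 'a) \<Rightarrow> 'a poly \<Rightarrow> 'a dpoly \<Rightarrow> 'a dpoly" where
  "dop_apply d L f = (\<Sum>k\<le>degree L. dconst (coeff L k) * (dderiv d ^^ k) f)"

definition dppe_H :: "('a::comm_ring_1 \<Rightarrow> 'a) \<Rightarrow> nat \<Rightarrow> (nat \<Rightarrow> nat \<Rightarrow> 'a poly) \<Rightarrow> nat \<Rightarrow> 'a dpoly" where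
  "dppe_H d n L i = (\<Sum>j\<in>{1..n-1}. dop_apply d (L i j) (dvariable (j, 0)))"

definition dppe_F :: "('a::comm_ring_1 \<Rightarrow> 'a) \<Rightarrow> nat \<Rightarrow> (nat \<Rightarrow> 'a) \<Rightarrow> (nat \<Rightarrow> nat \<Rightarrow> 'a poly)
    \<Rightarrow> nat \<Rightarrow> 'a dpoly dpoly" where
  "dppe_F d n a L i =
     dconst (dvariable (i, 0) - dconst (a i)) + Poly_Mapping.map dconst (dppe_H d n L i)"


text \<open>
  The order in U.  On \<open>F\<^sub>i\<close> in K{X}{U} this is also the order in X and U together, since \<open>x\<^sub>i\<close>
  occurs underived; on \<open>H\<^sub>i\<close> it has the same value.
\<close>

definition dorder :: "'a::zero dpoly \<Rightarrow> nat" where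
  "dorder p = (if dvars p = {} then 0 else Max (snd ` dvars p))"

definition order_sum :: "nat \<Rightarrow> (nat \<Rightarrow> 'a::zero dpoly) \<Rightarrow> nat" where
  "order_sum n F = (\<Sum>i\<in>{1..n}. dorder (F i))"

text \<open>\<open>p\<^sup>(\<^sup>r\<^sup>-\<^sup>1\<^sup>), \<dots>, p', p\<close>\<close>

definition deriv_block :: "('a::comm_ring_1 \<Rightarrow> 'a) \<Rightarrow> nat \<Rightarrow> 'a dpoly \<Rightarrow> 'a dpoly list" where
  "deriv_block d r p = map (\<lambda>k. (dderiv d ^^ k) p) (rev [0..<r])"

text \<open>The \<open>u\<^sub>j\<^sub>k\<close> with \<open>1 \<le> j \<le> n - 1\<close>, \<open>k < K\<close>, decreasing for the order by \<open>k\<close>, then \<open>j\<close>.\<close>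

definition u_columns :: "nat \<Rightarrow> nat \<Rightarrow> dmon list" where
  "u_columns n K = concat (map (\<lambda>k. map (\<lambda>j. vmon (j, k)) (rev [1..<n])) (rev [0..<K]))"

definition coeff_matrix :: "dmon list \<Rightarrow> 'a::zero dpoly list \<Rightarrow> 'a mat" where
  "coeff_matrix ms ps = mat_of_rows_list (length ms) (map (\<lambda>p. map (Poly_Mapping.lookup p) ms) ps)"

text \<open>The monomial \<open>0\<close> indexes the last column: it collects the terms free of U.\<close>

definition res_matrix :: "('b::comm_ring_1 \<Rightarrow> 'b) \<Rightarrow> nat \<Rightarrow> (nat \<Rightarrow> 'b dpoly) \<Rightarrow> 'b mat" where
  "res_matrix D n F = (let N = order_sum n F in
     coeff_matrix (u_columns n (N + 1) @ [0])
       (concat (map (\<lambda>i. deriv_block D (N - dorder (F i) + 1) (F i)) [1..<n+1])))"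

definition hom_res_matrix :: "('a::comm_ring_1 \<Rightarrow> 'a) \<Rightarrow> nat \<Rightarrow> (nat \<Rightarrow> 'a dpoly) \<Rightarrow> 'a mat" where
  "hom_res_matrix d n H = (let N = order_sum n H in
     coeff_matrix (u_columns n N)
       (concat (map (\<lambda>i. deriv_block d (N - dorder (H i)) (H i)) [1..<n+1])))"

text \<open>
  For \<open>diff_res\<close>, \<open>D\<close> is a derivation of the coefficient ring K{X} of the \<open>F\<^sub>i\<close>.

  Pitfall for \<open>diff_hom_res\<close>: if the orders sum to 0, the matrix is the empty one, whose
  determinant is 1 whatever the \<open>H\<^sub>i\<close> are.  For \<open>H\<^sub>1 = H\<^sub>2 = u\<^sub>1 + u\<^sub>2\<close> and \<open>H\<^sub>3 = 0\<close>, say, the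
  differential resultant of the \<open>F\<^sub>i\<close> vanishes although \<open>diff_hom_res\<close> is 1.
\<close>

definition diff_res :: "('b::comm_ring_1 \<Rightarrow> 'b) \<Rightarrow> nat \<Rightarrow> (nat \<Rightarrow> 'b dpoly) \<Rightarrow> 'b" where
  "diff_res D n F = det (res_matrix D n F)"

definition diff_hom_res :: "('a::comm_ring_1 \<Rightarrow> 'a) \<Rightarrow> nat \<Rightarrow> (nat \<Rightarrow> 'a dpoly) \<Rightarrow> 'a" where
  "diff_hom_res d n H = det (hom_res_matrix d n H)"

lemma dorder_le_order_sum: "i \<in> {1..n} \<Longrightarrow> dorder (F i) \<le> order_sum n F"
  unfolding order_sum_def by (rule member_le_sum) auto

lemma length_u_columns: "length (u_columns n K) = (n - 1) * K"
  by (simp add: u_columns_def length_concat comp_def sum_list_triv)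

lemma sum_list_upt_1: "sum_list (map f [1..<n+1]) = (\<Sum>i\<in>{1..n}. f i :: nat)"
  by (simp only: interv_sum_list_conv_sum_set_nat set_upt Suc_eq_plus1[symmetric]
      atLeastLessThanSuc_atLeastAtMost)

lemma coeff_matrix_carrier: "coeff_matrix ms ps \<in> carrier_mat (length ps) (length ms)"
  by (simp add: coeff_matrix_def mat_of_rows_list_def)

lemma length_deriv_blocks:
  "length (concat (map (\<lambda>i. deriv_block d (r i) (F i)) [1..<n+1])) = (\<Sum>i\<in>{1..n}. r i)"
  by (simp only: length_concat map_map comp_def deriv_block_def length_map length_rev length_upt
      diff_zero sum_list_upt_1)

lemma res_matrix_carrier:
  assumes "n \<ge> 1"
  shows "res_matrix D n F \<in> carrier_mat ((n - 1) * order_sum n F + n) ((n - 1) * order_sum n F + n)"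
proof -
  let ?N = "order_sum n F"
  have "(\<Sum>i\<in>{1..n}. ?N - dorder (F i) + 1) + ?N
      = (\<Sum>i\<in>{1..n}. (?N - dorder (F i) + 1) + dorder (F i))"
    by (simp only: sum.distrib order_sum_def)
  also have "\<dots> = (\<Sum>i\<in>{1..n}. ?N + 1)"
    using dorder_le_order_sum[of _ n F] by (intro sum.cong) auto
  also have "\<dots> = (n - 1) * ?N + n + ?N"
    using assms by (cases n) auto
  finally have "(\<Sum>i\<in>{1..n}. ?N - dorder (F i) + 1) = (n - 1) * ?N + n" by linarith
  moreover have "length (u_columns n (?N + 1) @ [0]) = (n - 1) * ?N + n"
    using assms by (simp add: length_u_columns)
  ultimately show ?thesis
    unfolding res_matrix_def Let_def
    by (intro carrier_matI)
       (simp_all only: carrier_matD[OF coeff_matrix_carrier] length_deriv_blocks)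
qed

lemma hom_res_matrix_carrier:
  assumes "n \<ge> 1"
  shows "hom_res_matrix d n H \<in> carrier_mat ((n - 1) * order_sum n H) ((n - 1) * order_sum n H)"
proof -
  let ?N = "order_sum n H"
  have "(\<Sum>i\<in>{1..n}. ?N - dorder (H i)) + ?N
      = (\<Sum>i\<in>{1..n}. (?N - dorder (H i)) + dorder (H i))"
    by (simp only: sum.distrib order_sum_def)
  also have "\<dots> = (\<Sum>i\<in>{1..n}. ?N)"
    using dorder_le_order_sum[of _ n H] by (intro sum.cong) auto
  also have "\<dots> = (n - 1) * ?N + ?N"
    using assms by (cases n) auto
  finally have "(\<Sum>i\<in>{1..n}. ?N - dorder (H i)) = (n - 1) * ?N" by linarith
  then show ?thesis
    unfolding hom_res_matrix_def Let_def
    by (intro carrier_matI)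
       (simp_all only: carrier_matD[OF coeff_matrix_carrier] length_deriv_blocks length_u_columns)
qed


definition implicit_ideal :: "('a::comm_ring_1 \<Rightarrow> 'a) \<Rightarrow> nat \<Rightarrow> (nat \<Rightarrow> 'a dpoly) \<Rightarrow> 'a dpoly set" where
  "implicit_ideal d n P = {f \<in> dring {1..n}. dsubst d P f = 0}"

text \<open>
  Characteristic sets in the sense of Ritt and Kolchin.  A ranking is a strict total order \<open>lt\<close>
  on the derivatives of \<open>x\<^sub>1, \<dots>, x\<^sub>n\<close>; its values at other pairs are irrelevant.
\<close>

definition ranking :: "nat \<Rightarrow> (dvar \<Rightarrow> dvar \<Rightarrow> bool) \<Rightarrow> bool" where
  "ranking n lt \<longleftrightarrow> (let V = {1..n} \<times> UNIV in
     irreflp_on V lt \<and> transp_on V lt \<and> totalp_on V lt \<and>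
     (\<forall>v\<in>V. lt v (dnext v)) \<and> (\<forall>v\<in>V. \<forall>w\<in>V. lt v w \<longrightarrow> lt (dnext v) (dnext w)))"

definition leader :: "(dvar \<Rightarrow> dvar \<Rightarrow> bool) \<Rightarrow> 'a::zero dpoly \<Rightarrow> dvar" where
  "leader lt p = (THE v. v \<in> dvars p \<and> (\<forall>w\<in>dvars p. w \<noteq> v \<longrightarrow> lt w v))"

definition var_degree :: "dvar \<Rightarrow> 'a::zero dpoly \<Rightarrow> nat" where
  "var_degree v p = Max (insert 0 ((\<lambda>m. Poly_Mapping.lookup m v) ` Poly_Mapping.keys p))"

definition leader_degree :: "(dvar \<Rightarrow> dvar \<Rightarrow> bool) \<Rightarrow> 'a::zero dpoly \<Rightarrow> nat" where
  "leader_degree lt p = var_degree (leader lt p) p"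

text \<open>The three relations below are only used for polynomials outside K, which have a leader,
  except that \<open>g\<close> in \<open>reduced_wrt\<close> may be any polynomial.\<close>

definition rank_less :: "(dvar \<Rightarrow> dvar \<Rightarrow> bool) \<Rightarrow> 'a::zero dpoly \<Rightarrow> 'a dpoly \<Rightarrow> bool" where
  "rank_less lt p q \<longleftrightarrow> lt (leader lt p) (leader lt q) \<or>
     (leader lt p = leader lt q \<and> leader_degree lt p < leader_degree lt q)"

definition rank_eq :: "(dvar \<Rightarrow> dvar \<Rightarrow> bool) \<Rightarrow> 'a::zero dpoly \<Rightarrow> 'a dpoly \<Rightarrow> bool" where
  "rank_eq lt p q \<longleftrightarrow> leader lt p = leader lt q \<and> leader_degree lt p = leader_degree lt q"

definition reduced_wrt :: "(dvar \<Rightarrow> dvar \<Rightarrow> bool) \<Rightarrow> 'a::zero dpoly \<Rightarrow> 'a dpoly \<Rightarrow> bool" where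
  "reduced_wrt lt g f \<longleftrightarrow>
     (\<forall>k\<ge>1. (dnext ^^ k) (leader lt f) \<notin> dvars g) \<and>
     var_degree (leader lt f) g < leader_degree lt f"

definition autoreduced :: "nat \<Rightarrow> (dvar \<Rightarrow> dvar \<Rightarrow> bool) \<Rightarrow> 'a::zero dpoly set \<Rightarrow> bool" where
  "autoreduced n lt C \<longleftrightarrow> C \<subseteq> dring {1..n} - range dconst \<and>
     (\<forall>g\<in>C. \<forall>f\<in>C. g \<noteq> f \<longrightarrow> reduced_wrt lt g f)"

text \<open>
  Autoreduced sets are finite; they are compared through their enumerations by increasing rank.
  In particular a proper extension of an autoreduced set is lower than that set.
\<close>

definition autoreduced_list :: "nat \<Rightarrow> (dvar \<Rightarrow> dvar \<Rightarrow> bool) \<Rightarrow> 'a::zero dpoly list \<Rightarrow> bool" where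
  "autoreduced_list n lt cs \<longleftrightarrow> autoreduced n lt (set cs) \<and> sorted_wrt (rank_less lt) cs"

definition lower_list :: "(dvar \<Rightarrow> dvar \<Rightarrow> bool) \<Rightarrow> 'a::zero dpoly list \<Rightarrow> 'a dpoly list \<Rightarrow> bool" where
  "lower_list lt as bs \<longleftrightarrow>
     (\<exists>k < min (length as) (length bs).
        (\<forall>i<k. rank_eq lt (as ! i) (bs ! i)) \<and> rank_less lt (as ! k) (bs ! k)) \<or>
     (length bs < length as \<and> (\<forall>i<length bs. rank_eq lt (as ! i) (bs ! i)))"

definition characteristic_set ::
    "nat \<Rightarrow> (dvar \<Rightarrow> dvar \<Rightarrow> bool) \<Rightarrow> 'a::zero dpoly set \<Rightarrow> 'a dpoly set \<Rightarrow> bool" where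
  "characteristic_set n lt I C \<longleftrightarrow>
     (\<exists>cs. set cs = C \<and> autoreduced_list n lt cs \<and> C \<subseteq> I \<and>
        \<not> (\<exists>bs. autoreduced_list n lt bs \<and> set bs \<subseteq> I \<and> lower_list lt bs cs))"

text \<open>
  The dimension \<open>n - card C\<close> does not depend on the ranking nor on the characteristic set C, so
  it is stated as a relation that demands the value \<open>m\<close> for all choices.
\<close>

definition has_diff_dimension :: "nat \<Rightarrow> 'a::zero dpoly set \<Rightarrow> nat \<Rightarrow> bool" where
  "has_diff_dimension n I m \<longleftrightarrow>
     (\<exists>lt C. ranking n lt \<and> characteristic_set n lt I C) \<and>
     (\<forall>lt C. ranking n lt \<and> characteristic_set n lt I C \<longrightarrow> n - card C = m)"

text \<open>
  Irreducibility in \<open>'a dpoly\<close> is irreducibility in K{X} for elements of K{X}, as all factors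
  of such an element again lie in K{X}.
\<close>

definition characteristic_polynomial :: "nat \<Rightarrow> 'a::field dpoly set \<Rightarrow> 'a dpoly \<Rightarrow> bool" where
  "characteristic_polynomial n I A \<longleftrightarrow> A \<in> dring {1..n} \<and> Factorial_Ring.irreducible A \<and>
     (\<forall>lt. ranking n lt \<longrightarrow> characteristic_set n lt I {A})"

end

theory Submission
  imports Defs "HOL-Library.Product_Lexorder"
begin

text \<open>
The matrix of the resultant has entries in K except in its last column, where the row of
\<open>\<partial>\<^sup>k F\<^sub>i\<close> carries \<open>\<partial>\<^sup>k (x\<^sub>i - a\<^sub>i)\<close>.  Expansion along that column writes the resultant as
\<open>A = \<Sum> c\<^sub>i\<^sub>k \<partial>\<^sup>k (x\<^sub>i - a\<^sub>i)\<close> with cofactors \<open>c\<^sub>i\<^sub>k\<close> in K, so A has degree at most one in the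
derivatives of the \<open>x\<^sub>i\<close>.  Replacing the last column by another column gives a determinant with
two equal columns, so \<open>\<Sum> c\<^sub>i\<^sub>k \<partial>\<^sup>k H\<^sub>i = 0\<close>; as \<open>P\<^sub>i = a\<^sub>i - H\<^sub>i\<close>, this says that A vanishes under
\<open>x\<^sub>i = P\<^sub>i\<close>.  Everything else is about the relations \<open>\<Sum> b\<^sub>i\<^sub>k \<partial>\<^sup>k H\<^sub>i = 0\<close> over K, which form a
left module over the ring of differential operators.

That module is free on the single relation c.  Grade relations by the windows
\<open>k < N - o\<^sub>i + m\<close>.  For \<open>m = 0\<close> there is none but 0, because the rows of the homogeneous matrix
are independent.  The top coefficients (at \<open>k = N - o\<^sub>i + m\<close>) of a relation of window \<open>m + 1\<close>
are in the left kernel of the n by n - 1 symbol matrix S, whose entry at (i, j) is the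
coefficient in \<open>H\<^sub>i\<close> of the \<open>o\<^sub>i\<close>-th derivative of \<open>u\<^sub>j\<close>.  S has full column rank, because the
columns of highest order of the homogeneous matrix contain nothing but rows of S and zeros (for
\<open>N = 0\<close>, where that matrix is empty, \<open>n = 2\<close> and S is a nonzero column), so that kernel is a line.
The top of c is a nonzero vector on it, since a relation with zero top would lie in window 0.  Hence some multiple of \<open>\<partial>\<^sup>m c\<close> lowers the window, and every relation is a combination of
the \<open>\<partial>\<^sup>t c\<close> (\<open>relation_generated\<close>).  That c itself is not 0 holds because the full matrix
becomes regular for a suitable last column over K (\<open>bordered_columns_independent\<close>,
\<open>bordered_det_relation\<close>).

Let v be the leader of A for some ranking, \<open>v = \<partial>\<^sup>k x\<^sub>i\<close> with i, k now fixed; then k is the highest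
order of \<open>x\<^sub>i\<close> in A.  Count v among its derivatives.  A nonzero combination of the \<open>\<partial>\<^sup>t c\<close> involves
a derivative of v, so the derivatives of the \<open>H\<^sub>j\<close> at the positions that are no derivatives of v are linearly independent
over K (\<open>forms_independent\<close>).  Polynomials of degree one with independent linear parts are
algebraically independent (\<open>affine_substitution_injective\<close>), so a member of the implicit ideal that
is free of all derivatives of v is 0.  A has degree one in v, so being reduced with respect
to A means exactly this freedom; hence {A} is a characteristic set and every characteristic set
has one element (\<open>characteristic_set_principal\<close>).  Finally A is irreducible because it has degree
one in v with a leading coefficient in K (\<open>affine_irreducible\<close>).
\<close>

section \<open>Finite linear systems over a field\<close>

lemma sum_list_index:
  assumes "distinct xs"
  shows "(\<Sum>i<length xs. g (xs ! i)) = (\<Sum>x\<in>set xs. g x)"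
  by (rule sum.reindex_bij_betw[OF bij_betw_nth[OF assms refl refl]])

lemma det_nonzero_iff_columns_independent:
  fixes f :: "'r \<Rightarrow> 'c \<Rightarrow> 'a::field"
  assumes rs: "distinct rs" and cs: "distinct cs" and len: "length rs = length cs"
  shows "det (mat (length rs) (length cs) (\<lambda>(i, j). f (rs ! i) (cs ! j))) \<noteq> 0 \<longleftrightarrow>
    (\<forall>y. (\<forall>r\<in>set rs. (\<Sum>c\<in>set cs. f r c * y c) = 0) \<longrightarrow> (\<forall>c\<in>set cs. y c = 0))"
proof -
  define k where "k = length cs"
  define A where "A = mat k k (\<lambda>(i, j). f (rs ! i) (cs ! j))"
  have A: "A \<in> carrier_mat k k" by (simp add: A_def)
  have lk: "length rs = k" using len k_def by simp
  have prod: "(A *\<^sub>v vec k (\<lambda>j. y (cs ! j))) $ i = (\<Sum>c\<in>set cs. f (rs ! i) c * y c)"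
    if "i < k" for i y
    using that sum_list_index[OF cs, of "\<lambda>c. f (rs ! i) c * y c"]
    by (simp add: A_def scalar_prod_def k_def lessThan_atLeast0)
  have "det A = 0 \<longleftrightarrow>
    (\<exists>y. (\<forall>r\<in>set rs. (\<Sum>c\<in>set cs. f r c * y c) = 0) \<and> (\<exists>c\<in>set cs. y c \<noteq> 0))" (is "_ \<longleftrightarrow> ?R")
  proof
    assume "det A = 0"
    then obtain v where v: "v \<in> carrier_vec k" "v \<noteq> 0\<^sub>v k" "A *\<^sub>v v = 0\<^sub>v k"
      using det_0_iff_vec_prod_zero_field[OF A] by blast
    define y where "y c = v $ inv_into {..<k} ((!) cs) c" for c
    have y: "y (cs ! j) = v $ j" if "j < k" for j
      unfolding y_def using that inv_into_f_f[OF inj_on_nth[OF cs], of "{..<k}" j] by (simp add: k_def)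
    have vy: "v = vec k (\<lambda>j. y (cs ! j))" using v(1) y by (intro eq_vecI) auto
    have "(\<Sum>c\<in>set cs. f (rs ! i) c * y c) = 0" if "i < k" for i
      using prod[OF that, of y] v(3) vy that by simp
    then have "\<forall>r\<in>set rs. (\<Sum>c\<in>set cs. f r c * y c) = 0"
      using lk by (auto simp: in_set_conv_nth)
    moreover have "\<exists>c\<in>set cs. y c \<noteq> 0"
    proof (rule ccontr)
      assume "\<not> ?thesis"
      then have "v = 0\<^sub>v k" using v(1) y k_def by (intro eq_vecI) (auto simp: nth_mem)
      with v(2) show False by simp
    qed
    ultimately show ?R by blast
  next
    assume ?R
    then obtain y c where y: "\<forall>r\<in>set rs. (\<Sum>c\<in>set cs. f r c * y c) = 0" and c: "c \<in> set cs" "y c \<noteq> 0"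
      by blast
    let ?v = "vec k (\<lambda>j. y (cs ! j))"
    obtain j where j: "j < k" "c = cs ! j" using c(1) by (auto simp: in_set_conv_nth k_def)
    have "?v \<noteq> 0\<^sub>v k"
    proof
      assume "?v = 0\<^sub>v k"
      then have "?v $ j = 0" using j by simp
      with j c show False by simp
    qed
    moreover have "A *\<^sub>v ?v = 0\<^sub>v k"
    proof (rule eq_vecI)
      fix i assume "i < dim_vec (0\<^sub>v k :: 'a vec)"
      then have i: "i < k" by simp
      then have "rs ! i \<in> set rs" using lk by simp
      with y prod[OF i, of y] i show "(A *\<^sub>v ?v) $ i = 0\<^sub>v k $ i" by simp
    qed (simp add: A_def)
    ultimately show "det A = 0"
      using det_0_iff_vec_prod_zero_field[OF A] by (metis vec_carrier)
  qed
  then show ?thesis unfolding A_def lk[symmetric] using lk k_def by auto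
qed

lemma det_nonzero_iff_rows_independent:
  fixes f :: "'r \<Rightarrow> 'c \<Rightarrow> 'a::field"
  assumes rs: "distinct rs" and cs: "distinct cs" and len: "length rs = length cs"
  shows "det (mat (length rs) (length cs) (\<lambda>(i, j). f (rs ! i) (cs ! j))) \<noteq> 0 \<longleftrightarrow>
    (\<forall>x. (\<forall>c\<in>set cs. (\<Sum>r\<in>set rs. x r * f r c) = 0) \<longrightarrow> (\<forall>r\<in>set rs. x r = 0))"
proof -
  let ?A = "mat (length rs) (length cs) (\<lambda>(i, j). f (rs ! i) (cs ! j))"
  have "det ?A = det (transpose_mat ?A)"
    using len by (intro det_transpose[symmetric, of _ "length rs"]) auto
  also have "transpose_mat ?A = mat (length cs) (length rs) (\<lambda>(i, j). f (rs ! j) (cs ! i))"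
    by (intro eq_matI) auto
  finally show ?thesis
    using det_nonzero_iff_columns_independent[OF cs rs len[symmetric], of "\<lambda>c r. f r c"]
    by (simp add: mult.commute)
qed

lemma square_columns_independent_imp_rows:
  fixes f :: "'r \<Rightarrow> 'c \<Rightarrow> 'a::field"
  assumes "finite R" "finite C" "card R = card C"
    and "\<And>y. \<forall>r\<in>R. (\<Sum>c\<in>C. f r c * y c) = 0 \<Longrightarrow> \<forall>c\<in>C. y c = 0"
    and "\<forall>c\<in>C. (\<Sum>r\<in>R. x r * f r c) = 0" and "r \<in> R"
  shows "x r = 0"
proof -
  obtain rs cs where l: "set rs = R" "distinct rs" "set cs = C" "distinct cs"
    using assms(1,2) finite_distinct_list by metis
  then have "length rs = length cs" using assms(3) distinct_card by metis
  from det_nonzero_iff_columns_independent[OF l(2,4) this, of f]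
    det_nonzero_iff_rows_independent[OF l(2,4) this, of f]
  have "(\<forall>c\<in>C. (\<Sum>r\<in>R. x r * f r c) = 0) \<longrightarrow> (\<forall>r\<in>R. x r = 0)"
    unfolding l using assms(4) by blast
  with assms(5,6) show ?thesis by blast
qed

lemma square_rows_independent_imp_columns:
  fixes f :: "'r \<Rightarrow> 'c \<Rightarrow> 'a::field"
  assumes "finite R" "finite C" "card R = card C"
    and inj: "\<And>x. \<forall>c\<in>C. (\<Sum>r\<in>R. x r * f r c) = 0 \<Longrightarrow> \<forall>r\<in>R. x r = 0"
    and y: "\<forall>r\<in>R. (\<Sum>c\<in>C. f r c * y c) = 0" and "c \<in> C"
  shows "y c = 0"
proof (rule square_columns_independent_imp_rows[where R = C and C = R and f = "\<lambda>c r. f r c"])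
  show "\<forall>r\<in>R. x r = 0" if "\<forall>c\<in>C. (\<Sum>r\<in>R. f r c * x r) = 0" for x
    by (rule inj) (use that in \<open>simp only: mult.commute[of "x _"]\<close>)
  show "\<forall>r\<in>R. (\<Sum>c\<in>C. y c * f r c) = 0"
    using y by (simp only: mult.commute[of "y _"])
qed (use assms in auto)

text \<open>
With one row more than columns, a zero column makes the system square and singular.
\<close>

lemma left_kernel_nontrivial:
  fixes f :: "'r \<Rightarrow> 'c \<Rightarrow> 'a::field"
  assumes R: "finite R" and C: "finite C" and card: "card R = Suc (card C)"
  obtains x r where "\<forall>c\<in>C. (\<Sum>r\<in>R. x r * f r c) = 0" "r \<in> R" "x r \<noteq> 0"
proof -
  define C' where "C' = insert None (Some ` C)"
  define g where "g r c = (case c of None \<Rightarrow> 0 | Some c \<Rightarrow> f r c)" for r c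
  define y where "y c = (case c of None \<Rightarrow> 1 | Some c \<Rightarrow> (0::'a))" for c :: "'c option"
  have C': "finite C'" "card R = card C'" using C card by (simp_all add: C'_def card_image)
  have "\<exists>x. (\<forall>c\<in>C'. (\<Sum>r\<in>R. x r * g r c) = 0) \<and> \<not> (\<forall>r\<in>R. x r = 0)"
  proof (rule ccontr)
    assume "\<not> ?thesis"
    then have inj: "\<And>x. \<forall>c\<in>C'. (\<Sum>r\<in>R. x r * g r c) = 0 \<Longrightarrow> \<forall>r\<in>R. x r = 0" by blast
    have "\<forall>r\<in>R. (\<Sum>c\<in>C'. g r c * y c) = 0"
      by (auto simp: g_def y_def split: option.splits intro!: sum.neutral)
    from square_rows_independent_imp_columns[OF R C' inj this, of None]
    show False by (simp add: C'_def y_def)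
  qed
  then obtain x r where x: "\<forall>c\<in>C'. (\<Sum>r\<in>R. x r * g r c) = 0" "r \<in> R" "x r \<noteq> 0" by blast
  have "\<forall>c\<in>C. (\<Sum>r\<in>R. x r * f r c) = 0" using x(1) by (simp add: C'_def g_def)
  from that[OF this x(2,3)] show thesis .
qed

text \<open>
Bordering the injective matrix by a unit column at a position where \<open>x\<close> does not vanish gives a
regular square matrix; the multiple of \<open>x\<close> that agrees with \<open>z\<close> there differs from \<open>z\<close> by a row
vector that this matrix kills.
\<close>

lemma left_kernel_one_dimensional:
  fixes f :: "'r \<Rightarrow> 'c \<Rightarrow> 'a::field"
  assumes R: "finite R" and C: "finite C" and card: "card R = Suc (card C)"
    and inj: "\<And>y. \<forall>r\<in>R. (\<Sum>c\<in>C. f r c * y c) = 0 \<Longrightarrow> \<forall>c\<in>C. y c = 0"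
    and x: "\<forall>c\<in>C. (\<Sum>r\<in>R. x r * f r c) = 0" and r0: "r0 \<in> R" "x r0 \<noteq> 0"
    and z: "\<forall>c\<in>C. (\<Sum>r\<in>R. z r * f r c) = 0"
  obtains q where "\<forall>r\<in>R. z r = q * x r"
proof -
  let ?C = "insert None (Some ` C)"
  let ?g = "\<lambda>r c. case c of None \<Rightarrow> (if r = r0 then 1 else 0) | Some c \<Rightarrow> f r c"
  define q where "q = z r0 / x r0"
  define w where "w r = z r - q * x r" for r
  have cC: "card R = card ?C" using C card by (simp add: card_image)
  have split: "(\<Sum>c\<in>?C. ?g r c * y c) = ?g r None * y None + (\<Sum>c\<in>C. f r c * y (Some c))" for r y
    using C by (simp add: sum.reindex)
  \<comment> \<open>The bordered square system is regular: pairing a solution with \<open>x\<close> kills the new unknown.\<close>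
  have "\<forall>c\<in>?C. y c = 0" if y: "\<forall>r\<in>R. (\<Sum>c\<in>?C. ?g r c * y c) = 0" for y
  proof -
    have eq: "?g r None * y None + (\<Sum>c\<in>C. f r c * y (Some c)) = 0" if "r \<in> R" for r
      using y that unfolding split by blast
    have "0 = (\<Sum>r\<in>R. x r * (?g r None * y None + (\<Sum>c\<in>C. f r c * y (Some c))))"
      using eq by simp
    also have "\<dots> = (\<Sum>r\<in>R. x r * ?g r None * y None) + (\<Sum>r\<in>R. \<Sum>c\<in>C. x r * f r c * y (Some c))"
      by (simp add: distrib_left sum.distrib sum_distrib_left mult.assoc)
    also have "(\<Sum>r\<in>R. \<Sum>c\<in>C. x r * f r c * y (Some c)) = (\<Sum>c\<in>C. (\<Sum>r\<in>R. x r * f r c) * y (Some c))"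
      by (subst sum.swap) (simp add: sum_distrib_right)
    also have "\<dots> = 0" using x by simp
    also have "(\<Sum>r\<in>R. x r * ?g r None * y None) = (\<Sum>r\<in>R. if r = r0 then x r0 * y None else 0)"
      by (intro sum.cong) auto
    also have "\<dots> = x r0 * y None" using R r0(1) by simp
    finally have N: "y None = 0" using r0(2) by simp
    then have "\<forall>c\<in>C. y (Some c) = 0" using inj[of "\<lambda>c. y (Some c)"] eq by auto
    with N show ?thesis by auto
  qed
  moreover have "(\<Sum>r\<in>R. w r * f r c) = 0" if "c \<in> C" for c
  proof -
    have "(\<Sum>r\<in>R. w r * f r c) = (\<Sum>r\<in>R. z r * f r c) - q * (\<Sum>r\<in>R. x r * f r c)"
      unfolding w_def by (simp add: left_diff_distrib sum_subtractf sum_distrib_left mult.assoc)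
    then show ?thesis using x z that by simp
  qed
  moreover have "(\<Sum>r\<in>R. w r * (if r = r0 then 1 else 0)) = 0"
  proof (rule sum.neutral, rule ballI)
    fix r assume "r \<in> R"
    show "w r * (if r = r0 then 1 else 0) = 0" using r0 by (simp add: w_def q_def)
  qed
  ultimately have "w r = 0" if "r \<in> R" for r
    using square_columns_independent_imp_rows[OF R _ cC, of ?g w r] C that by auto
  then show thesis using that[of q] by (simp add: w_def)
qed

text \<open>
Induction on the family, as in the Gram-Schmidt process: the new functional is a point evaluation
corrected to vanish on the old members, and the old functionals are then corrected to vanish on the
new member.
\<close>

lemma dual_family_exists:
  fixes f :: "'w \<Rightarrow> 'v \<Rightarrow> 'a::field"
  assumes "finite W" "finite V"
    and "\<And>b. \<forall>v\<in>V. (\<Sum>w\<in>W. b w * f w v) = 0 \<Longrightarrow> \<forall>w\<in>W. b w = 0"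
  shows "\<exists>y. \<forall>w\<in>W. \<forall>w'\<in>W. (\<Sum>v\<in>V. f w' v * y w v) = (if w = w' then 1 else 0)"
  using assms(1,3)
proof (induction W rule: finite_induct)
  case empty
  show ?case by simp
next
  case (insert u W)
  have "\<forall>w\<in>W. b w = 0" if b: "\<forall>v\<in>V. (\<Sum>w\<in>W. b w * f w v) = 0" for b
  proof -
    have "(\<Sum>w\<in>insert u W. (b(u := 0)) w * f w v) = (\<Sum>w\<in>W. b w * f w v)" for v
      using insert.hyps by (simp, intro sum.cong) auto
    with b have "\<forall>w\<in>insert u W. (b(u := 0)) w = 0" by (intro insert.prems) simp
    then show ?thesis using insert.hyps(2) by (auto split: if_splits)
  qed
  from insert.IH[OF this] obtain y
    where y: "\<And>w w'. w \<in> W \<Longrightarrow> w' \<in> W \<Longrightarrow> (\<Sum>v\<in>V. f w' v * y w v) = (if w = w' then 1 else 0)" by blast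
  define s where "s w = (\<Sum>v\<in>V. f u v * y w v)" for w
  define p where "p v = f u v - (\<Sum>w\<in>W. s w * f w v)" for v
  \<comment> \<open>Independence leaves a coordinate where \<open>f u\<close> differs from its projection to the span.\<close>
  obtain v0 where v0: "v0 \<in> V" "p v0 \<noteq> 0"
  proof (rule ccontr)
    assume "\<not> thesis"
    then have p0: "\<forall>v\<in>V. p v = 0" using that by blast
    let ?b = "\<lambda>w. if w = u then 1 else - s w"
    have "(\<Sum>w\<in>insert u W. ?b w * f w v) = p v" for v
    proof -
      have "(\<Sum>w\<in>W. ?b w * f w v) = - (\<Sum>w\<in>W. s w * f w v)"
        using insert.hyps(2) by (auto simp: sum_negf[symmetric] intro!: sum.cong)
      then show ?thesis using insert.hyps by (simp add: p_def)
    qed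
    with p0 have "\<forall>w\<in>insert u W. ?b w = 0" by (intro insert.prems) simp
    then show False by simp
  qed
  define z where "z v = ((if v = v0 then 1 else 0) - (\<Sum>w\<in>W. f w v0 * y w v)) / p v0" for v
  have pair_z: "(\<Sum>v\<in>V. g v * z v) = (g v0 - (\<Sum>w\<in>W. f w v0 * (\<Sum>v\<in>V. g v * y w v))) / p v0" for g
  proof -
    have "(\<Sum>v\<in>V. g v * z v)
      = ((\<Sum>v\<in>V. g v * (if v = v0 then 1 else 0)) - (\<Sum>v\<in>V. g v * (\<Sum>w\<in>W. f w v0 * y w v))) / p v0"
      by (simp add: z_def sum_divide_distrib[symmetric] right_diff_distrib sum_subtractf)
    also have "(\<Sum>v\<in>V. g v * (if v = v0 then 1 else 0)) = (\<Sum>v\<in>V. if v = v0 then g v0 else 0)"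
      by (intro sum.cong) auto
    also have "\<dots> = g v0" using v0(1) assms(2) by simp
    also have "(\<Sum>v\<in>V. g v * (\<Sum>w\<in>W. f w v0 * y w v)) = (\<Sum>w\<in>W. f w v0 * (\<Sum>v\<in>V. g v * y w v))"
      unfolding sum_distrib_left by (subst sum.swap) (simp add: mult.left_commute)
    finally show ?thesis .
  qed
  have zW: "(\<Sum>v\<in>V. f w' v * z v) = 0" if "w' \<in> W" for w'
  proof -
    have "(\<Sum>w\<in>W. f w v0 * (\<Sum>v\<in>V. f w' v * y w v)) = (\<Sum>w\<in>W. if w = w' then f w' v0 else 0)"
      using y that by (intro sum.cong) auto
    then show ?thesis using that insert.hyps(1) by (simp add: pair_z)
  qed
  have zu: "(\<Sum>v\<in>V. f u v * z v) = 1"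
    using v0(2) unfolding pair_z by (simp add: p_def s_def mult.commute)
  define x where "x w v = (if w = u then z v else y w v - s w * z v)" for w v
  have xW: "(\<Sum>v\<in>V. f w' v * x w v) = (\<Sum>v\<in>V. f w' v * y w v) - s w * (\<Sum>v\<in>V. f w' v * z v)"
    if "w \<noteq> u" for w w'
    using that by (simp add: x_def right_diff_distrib sum_subtractf sum_distrib_left mult.left_commute)
  have xu: "(\<Sum>v\<in>V. f w' v * x u v) = (\<Sum>v\<in>V. f w' v * z v)" for w' by (simp add: x_def)
  have "(\<Sum>v\<in>V. f w' v * x w v) = (if w = w' then 1 else 0)" if "w \<in> insert u W" "w' \<in> insert u W" for w w'
  proof (cases "w = u")
    case True
    then show ?thesis using that insert.hyps(2) zW zu by (auto simp: xu)
  next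
    case False
    then show ?thesis using that insert.hyps(2) zW zu y by (auto simp: xW s_def[symmetric])
  qed
  then show ?case by blast
qed

text \<open>
The cofactors of the last column do not depend on that column, and they commute with the ring
homomorphism \<open>h\<close>.  Their orthogonality to the other columns is the expansion of a determinant with
two equal columns.  The same coefficients thus serve the matrix over K{X}, whose last column has the
interesting entries, and the matrix over K, where regularity is tested.
\<close>

lemma det_bordered_expansion:
  fixes G :: "'r \<Rightarrow> 'c \<Rightarrow> 'a::field" and h :: "'a \<Rightarrow> 'b::comm_ring_1"
  assumes rs: "distinct rs" and cs: "distinct cs" and len: "length rs = Suc (length cs)"
    and h: "comm_ring_hom h"
  defines "k \<equiv> length cs"
  obtains g :: "'r \<Rightarrow> 'a" where
    "\<And>c. c \<in> set cs \<Longrightarrow> (\<Sum>r\<in>set rs. g r * G r c) = 0"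
    "\<And>w. det (mat (Suc k) (Suc k) (\<lambda>(i, j). if j < k then G (rs ! i) (cs ! j) else w (rs ! i)))
       = (\<Sum>r\<in>set rs. g r * w r)"
    "\<And>w. det (mat (Suc k) (Suc k) (\<lambda>(i, j). if j < k then h (G (rs ! i) (cs ! j)) else w (rs ! i)))
       = (\<Sum>r\<in>set rs. h (g r) * w r)"
proof -
  define M where "M w = mat (Suc k) (Suc k) (\<lambda>(i, j). if j < k then G (rs ! i) (cs ! j) else w (rs ! i))"
    for w
  define Mh where "Mh w = mat (Suc k) (Suc k) (\<lambda>(i, j). if j < k then h (G (rs ! i) (cs ! j)) else w (rs ! i))"
    for w :: "'r \<Rightarrow> 'b"
  define g where "g r = cofactor (M (\<lambda>_. 0)) (inv_into {..<Suc k} ((!) rs) r) k" for r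
  have lr: "length rs = Suc k" using len by (simp add: k_def)
  have g: "g (rs ! i) = cofactor (M (\<lambda>_. 0)) i k" if "i < Suc k" for i
    unfolding g_def using that lr inv_into_f_f[OF inj_on_nth[OF rs], of "{..<Suc k}" i] by simp
  have "det (M w) = (\<Sum>i<Suc k. M w $$ (i, k) * cofactor (M w) i k)" for w
    by (rule laplace_expansion_column) (auto simp: M_def)
  moreover have "mat_delete (M w) i k = mat_delete (M (\<lambda>_. 0)) i k" if "i < Suc k" for i w
    using that by (intro eq_matI) (auto simp: mat_delete_def M_def)
  ultimately have "det (M w) = (\<Sum>i<Suc k. w (rs ! i) * g (rs ! i))" for w
    by (auto intro!: sum.cong simp: g cofactor_def M_def)
  then have E: "det (M w) = (\<Sum>r\<in>set rs. g r * w r)" for w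
    using sum_list_index[OF rs, of "\<lambda>r. w r * g r"] lr by (simp add: mult.commute)
  interpret h: comm_ring_hom h by (rule h)
  have "det (Mh w) = (\<Sum>i<Suc k. Mh w $$ (i, k) * cofactor (Mh w) i k)" for w
    by (rule laplace_expansion_column) (auto simp: Mh_def)
  moreover have "mat_delete (Mh w) i k = map_mat h (mat_delete (M (\<lambda>_. 0)) i k)" if "i < Suc k" for i w
    using that by (intro eq_matI) (auto simp: mat_delete_def M_def Mh_def)
  ultimately have "det (Mh w) = (\<Sum>i<Suc k. w (rs ! i) * h (g (rs ! i)))" for w
    by (auto intro!: sum.cong simp: g cofactor_def Mh_def h.hom_mult h.hom_power h.hom_uminus)
  then have Eh: "det (Mh w) = (\<Sum>r\<in>set rs. h (g r) * w r)" for w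
    using sum_list_index[OF rs, of "\<lambda>r. w r * h (g r)"] lr by (simp add: mult.commute)
  have "(\<Sum>r\<in>set rs. g r * G r c) = 0" if c: "c \<in> set cs" for c
  proof -
    obtain j where j: "j < k" "c = cs ! j" using c unfolding in_set_conv_nth k_def by blast
    have "det (M (\<lambda>r. G r c)) = 0"
      by (rule det_identical_columns[of _ "Suc k" j k])
        (use j in \<open>simp_all add: M_def vec_eq_iff\<close>)
    then show ?thesis by (simp add: E)
  qed
  from that[OF this E[unfolded M_def] Eh[unfolded Mh_def]] show thesis .
qed

section \<open>Linear forms and the relations between their derivatives\<close>

lemma derivation_simps:
  assumes "derivation d"
  shows "d 0 = 0" "d (a + b) = d a + d b" "d (a * b) = d a * b + a * d b" "d 1 = 0"
    "d (- a) = - d a" "d (a - b) = d a - d b"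
proof -
  show add: "d (a + b) = d a + d b" for a b using assms by (simp add: derivation_def)
  show mult: "d (a * b) = d a * b + a * d b" for a b using assms by (simp add: derivation_def)
  show zero: "d 0 = 0" using add[of 0 0] by simp
  show "d 1 = 0" using mult[of 1 1] by simp
  show um: "d (- a) = - d a" for a using add[of a "- a"] zero by (simp add: eq_neg_iff_add_eq_0 add.commute)
  show "d (a - b) = d a - d b" for a b using add[of a "- b"] um[of b] by simp
qed

lemma derivation_sum:
  assumes "derivation d"
  shows "d (\<Sum>x\<in>A. f x) = (\<Sum>x\<in>A. d (f x))"
  by (induction A rule: infinite_finite_induct) (simp_all add: derivation_simps[OF assms])

text \<open>
A linear form in the derivatives of the indeterminates is represented by its coefficient function;
this is the action of the derivation on such coefficients.
\<close>

definition form_deriv :: "('a::comm_ring_1 \<Rightarrow> 'a) \<Rightarrow> (dvar \<Rightarrow> 'a) \<Rightarrow> dvar \<Rightarrow> 'a" where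
  "form_deriv d f v = d (f v) + (case snd v of 0 \<Rightarrow> 0 | Suc k \<Rightarrow> f (fst v, k))"

text \<open>
Differentiation shifts the highest order of an indeterminate by one and leaves its coefficient
unchanged, since the derivatives of the coefficients only appear in lower orders.
\<close>

lemma form_deriv_pow_top:
  assumes "derivation d" and "\<And>k. k > K \<Longrightarrow> f (i, k) = 0"
  shows "(\<forall>k > K + t. (form_deriv d ^^ t) f (i, k) = 0) \<and> (form_deriv d ^^ t) f (i, K + t) = f (i, K)"
proof (induction t)
  case 0
  then show ?case using assms(2) by simp
next
  case (Suc t)
  then show ?case
    by (auto simp: form_deriv_def derivation_simps(1)[OF assms(1)] split: nat.splits)
qed

lemma form_deriv_pow_eq_0:
  assumes "derivation d" and "\<And>k. f (i, k) = 0"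
  shows "(form_deriv d ^^ t) f (i, k) = 0"
  by (induction t arbitrary: k)
    (auto simp: form_deriv_def derivation_simps(1)[OF assms(1)] assms(2) split: nat.splits)

lemma form_deriv_linear_combination:
  assumes "derivation d"
  shows "form_deriv d (\<lambda>v. \<Sum>w\<in>W. b w * f w v) v =
    (\<Sum>w\<in>W. d (b w) * f w v) + (\<Sum>w\<in>W. b w * form_deriv d (f w) v)"
  by (cases "snd v") (simp_all add: form_deriv_def derivation_sum[OF assms] derivation_simps[OF assms]
      sum.distrib distrib_left)

text \<open>
The linear forms \<open>h i\<close> of order at most \<open>ord i\<close>, together with what the nonvanishing of the
homogeneous resultant gives: the square matrix has independent rows and independent columns, and the
symbol matrix, formed by the coefficients of order \<open>ord i\<close>, is injective.  The symbol has its own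
condition because the square matrix is empty for \<open>N = 0\<close> and then says nothing about it.
\<close>

locale regular_linear_forms =
  fixes d :: "'a::field \<Rightarrow> 'a" and n :: nat and h :: "nat \<Rightarrow> dvar \<Rightarrow> 'a"
    and ord :: "nat \<Rightarrow> nat" and N :: nat
  assumes d: "derivation d" and n: "n \<ge> 1"
    and ord_le: "\<And>i. i \<in> {1..n} \<Longrightarrow> ord i \<le> N"
    and h_support: "\<And>i j k. i \<in> {1..n} \<Longrightarrow> h i (j, k) \<noteq> 0 \<Longrightarrow> j \<in> {1..n-1} \<and> k \<le> ord i"
    and rows_independent: "\<And>b. \<forall>v\<in>{1..n-1} \<times> {..<N}.
        (\<Sum>w\<in>(SIGMA i:{1..n}. {..<N - ord i}). b w * (form_deriv d ^^ snd w) (h (fst w)) v) = 0 \<Longrightarrow>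
        \<forall>w\<in>(SIGMA i:{1..n}. {..<N - ord i}). b w = 0"
    and columns_independent: "\<And>y. \<forall>w\<in>(SIGMA i:{1..n}. {..<N - ord i}).
        (\<Sum>v\<in>{1..n-1} \<times> {..<N}. (form_deriv d ^^ snd w) (h (fst w)) v * y v) = 0 \<Longrightarrow>
        \<forall>v\<in>{1..n-1} \<times> {..<N}. y v = 0"
    and symbol_injective: "\<And>y. \<forall>i\<in>{1..n}. (\<Sum>j\<in>{1..n-1}. h i (j, ord i) * y j) = 0 \<Longrightarrow>
        \<forall>j\<in>{1..n-1}. y j = 0"
begin

definition form :: "dvar \<Rightarrow> dvar \<Rightarrow> 'a" where
  "form w = (form_deriv d ^^ snd w) (h (fst w))"

text \<open>
The positions of \<open>\<partial>\<^sup>k (h i)\<close> of order less than \<open>N + m\<close>: those of the rows of the homogeneous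
matrix for \<open>m = 0\<close>, and those of the rows of the resultant for \<open>m = 1\<close>.
\<close>

definition window :: "nat \<Rightarrow> dvar set" where
  "window m = (SIGMA i:{1..n}. {..<N - ord i + m})"

definition relation :: "nat \<Rightarrow> (dvar \<Rightarrow> 'a) \<Rightarrow> bool" where
  "relation m b \<longleftrightarrow> (\<forall>w. w \<notin> window m \<longrightarrow> b w = 0) \<and> (\<forall>v. (\<Sum>w\<in>window m. b w * form w v) = 0)"

lemma relationI:
  "(\<And>w. w \<notin> window m \<Longrightarrow> b w = 0) \<Longrightarrow> (\<And>v. (\<Sum>w\<in>window m. b w * form w v) = 0) \<Longrightarrow> relation m b"
  unfolding relation_def by blast

lemma relation_support: "relation m b \<Longrightarrow> w \<notin> window m \<Longrightarrow> b w = 0"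
  unfolding relation_def by blast

lemma relation_sum: "relation m b \<Longrightarrow> (\<Sum>w\<in>window m. b w * form w v) = 0"
  unfolding relation_def by blast

lemma finite_window [simp]: "finite (window m)"
  by (simp add: window_def)

lemma sum_window: "(\<Sum>w\<in>window m. g w) = (\<Sum>i\<in>{1..n}. \<Sum>k<N - ord i + m. g (i, k))"
  unfolding window_def by (subst sum.Sigma) (simp_all add: split_def)

lemma window_mono: "m \<le> m' \<Longrightarrow> window m \<subseteq> window m'"
  by (auto simp: window_def)

lemma form_support:
  assumes "i \<in> {1..n}" "form (i, k) (j, l) \<noteq> 0"
  shows "j \<in> {1..n-1}" "l \<le> ord i + k"
proof -
  show "j \<in> {1..n-1}"
    using form_deriv_pow_eq_0[OF d, of "h i" j k l] h_support[OF assms(1)] assms(2)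
    by (auto simp: form_def)
  show "l \<le> ord i + k"
    using form_deriv_pow_top[OF d, of "ord i" "h i" j k] h_support[OF assms(1), of j] assms(2)
    by (auto simp: form_def not_le[symmetric])
qed

lemma form_top:
  assumes "i \<in> {1..n}"
  shows "form (i, k) (j, ord i + k) = h i (j, ord i)"
  using form_deriv_pow_top[OF d, of "ord i" "h i" j k] h_support[OF assms, of j]
  by (auto simp: form_def not_le[symmetric])

lemma relation_diff:
  assumes "relation m b" "relation m c"
  shows "relation m (\<lambda>w. b w - q * c w)"
proof -
  have "(\<Sum>w\<in>window m. (b w - q * c w) * form w v)
    = (\<Sum>w\<in>window m. b w * form w v) - q * (\<Sum>w\<in>window m. c w * form w v)" for v
    by (simp add: left_diff_distrib sum_subtractf sum_distrib_left mult.assoc)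
  then show ?thesis
    using assms by (intro relationI) (simp_all add: relation_support relation_sum)
qed

lemma relation_0_imp_0:
  assumes "relation 0 b"
  shows "b w = 0"
proof (cases "w \<in> window 0")
  case True
  have "\<forall>w\<in>window 0. b w = 0"
    using rows_independent[of b] relation_sum[OF assms] by (simp add: window_def form_def)
  with True show ?thesis by blast
qed (rule relation_support[OF assms])

text \<open>
Differentiating the identity \<open>\<Sum> b\<^sub>w \<partial>\<^sup>k h\<^sub>i = 0\<close>, with \<open>w = (i, k)\<close>, gives an identity of the same
kind whose coefficients are those of the derivative of \<open>b\<close>, read as a linear form.
\<close>

lemma relation_deriv:
  assumes b: "relation m b"
  shows "relation (Suc m) (form_deriv d b)"
proof -
  have b0: "b (i, N - ord i + m) = 0" for i
    by (rule relation_support[OF b]) (simp add: window_def)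
  have supp: "form_deriv d b w = 0" if w: "w \<notin> window (Suc m)" for w
  proof -
    obtain i k where ik: "w = (i, k)" by force
    have "b (i, k) = 0" using w window_mono[of m "Suc m"] ik by (intro relation_support[OF b]) auto
    moreover have "b (i, k') = 0" if "k = Suc k'" for k'
      by (rule relation_support[OF b]) (use w that ik in \<open>auto simp: window_def\<close>)
    ultimately show ?thesis
      by (simp add: ik form_deriv_def derivation_simps(1)[OF d] split: nat.split)
  qed
  have "(\<Sum>w\<in>window (Suc m). form_deriv d b w * form w v) = 0" for v
  proof -
    have "0 = form_deriv d (\<lambda>v. \<Sum>w\<in>window m. b w * form w v) v"
      by (simp add: relation_sum[OF b] form_deriv_def derivation_simps(1)[OF d] split: nat.split)
    also have "\<dots> = (\<Sum>w\<in>window m. d (b w) * form w v) + (\<Sum>w\<in>window m. b w * form (dnext w) v)"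
      by (simp add: form_deriv_linear_combination[OF d] form_def dnext_def)
    also have "\<dots> = (\<Sum>i\<in>{1..n}. (\<Sum>k<N - ord i + m. d (b (i, k)) * form (i, k) v)
        + (\<Sum>k<N - ord i + m. b (i, k) * form (i, Suc k) v))"
      by (simp add: sum_window dnext_def sum.distrib)
    also have "\<dots> = (\<Sum>i\<in>{1..n}. \<Sum>k<Suc (N - ord i + m). form_deriv d b (i, k) * form (i, k) v)"
    proof (rule sum.cong[OF refl])
      fix i
      let ?K = "N - ord i + m"
      have "(\<Sum>k<Suc ?K. form_deriv d b (i, k) * form (i, k) v)
        = (\<Sum>k<Suc ?K. d (b (i, k)) * form (i, k) v)
          + (\<Sum>k<Suc ?K. (case k of 0 \<Rightarrow> 0 | Suc k \<Rightarrow> b (i, k)) * form (i, k) v)"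
        by (simp only: form_deriv_def sum.distrib[symmetric] distrib_right fst_conv snd_conv)
      also have "(\<Sum>k<Suc ?K. d (b (i, k)) * form (i, k) v) = (\<Sum>k<?K. d (b (i, k)) * form (i, k) v)"
        by (simp add: b0 derivation_simps(1)[OF d])
      also have "(\<Sum>k<Suc ?K. (case k of 0 \<Rightarrow> 0 | Suc k \<Rightarrow> b (i, k)) * form (i, k) v)
        = (\<Sum>k<?K. b (i, k) * form (i, Suc k) v)"
        by (subst sum.lessThan_Suc_shift) simp
      finally show "(\<Sum>k<?K. d (b (i, k)) * form (i, k) v) + (\<Sum>k<?K. b (i, k) * form (i, Suc k) v)
        = (\<Sum>k<Suc ?K. form_deriv d b (i, k) * form (i, k) v)" by simp
    qed
    also have "\<dots> = (\<Sum>w\<in>window (Suc m). form_deriv d b w * form w v)"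
      by (simp only: sum_window add_Suc_right)
    finally show ?thesis by simp
  qed
  with supp show ?thesis by (rule relationI)
qed

lemma relation_deriv_pow: "relation m b \<Longrightarrow> relation (m + t) ((form_deriv d ^^ t) b)"
  by (induction t) (auto intro: relation_deriv)

text \<open>
In order \<open>N + m\<close> only the last element of the window contributes for each \<open>i\<close>, and it contributes
the symbol of \<open>h i\<close>.
\<close>

lemma relation_top_in_left_kernel:
  assumes b: "relation (Suc m) b"
  shows "\<forall>j\<in>{1..n-1}. (\<Sum>i\<in>{1..n}. b (i, N - ord i + m) * h i (j, ord i)) = 0"
proof
  fix j assume "j \<in> {1..n-1}"
  have "0 = (\<Sum>w\<in>window (Suc m). b w * form w (j, N + m))"
    by (rule relation_sum[OF b, symmetric])
  also have "\<dots> = (\<Sum>i\<in>{1..n}. \<Sum>k<Suc (N - ord i + m). b (i, k) * form (i, k) (j, N + m))"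
    by (simp only: sum_window add_Suc_right)
  also have "\<dots> = (\<Sum>i\<in>{1..n}. b (i, N - ord i + m) * h i (j, ord i))"
  proof (rule sum.cong[OF refl])
    fix i assume i: "i \<in> {1..n}"
    have "form (i, k) (j, N + m) = 0" if "k < N - ord i + m" for k
      using form_support(2)[OF i, of k j "N + m"] that ord_le[OF i] by force
    moreover have "form (i, N - ord i + m) (j, N + m) = h i (j, ord i)"
      using form_top[OF i, of "N - ord i + m" j] ord_le[OF i] by simp
    ultimately show "(\<Sum>k<Suc (N - ord i + m). b (i, k) * form (i, k) (j, N + m))
        = b (i, N - ord i + m) * h i (j, ord i)" by simp
  qed
  finally show "(\<Sum>i\<in>{1..n}. b (i, N - ord i + m) * h i (j, ord i)) = 0" by simp
qed

lemma relation_lower: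
  assumes "relation (Suc m) b" and "\<And>i. i \<in> {1..n} \<Longrightarrow> b (i, N - ord i + m) = 0"
  shows "relation m b"
proof -
  have supp: "b w = 0" if "w \<notin> window m" for w
  proof (cases "w \<in> window (Suc m)")
    case True
    then have "w = (fst w, N - ord (fst w) + m)" "fst w \<in> {1..n}"
      using that by (auto simp: window_def)
    then show ?thesis using assms(2) by metis
  qed (rule relation_support[OF assms(1)])
  moreover have "(\<Sum>w\<in>window (Suc m). b w * form w v) = (\<Sum>w\<in>window m. b w * form w v)" for v
    by (rule sum.mono_neutral_right) (use supp window_mono[of m "Suc m"] in auto)
  ultimately show ?thesis using relation_sum[OF assms(1)] by (intro relationI) auto
qed

text \<open>
The left kernel of the symbol matrix is a line on which the top of \<open>c\<close> is nonzero, because the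
only relation of window 0 is 0.  A multiple of the derivative of \<open>c\<close> of order \<open>m\<close> therefore
cancels the top of any relation of window \<open>m + 1\<close>.
\<close>

lemma relation_generated:
  assumes c: "relation 1 c" and c0: "c w0 \<noteq> 0" and b: "relation m b"
  shows "\<exists>q. \<forall>w. b w = (\<Sum>t<m. q t * (form_deriv d ^^ t) c w)"
  using b
proof (induction m arbitrary: b)
  case 0
  then show ?case using relation_0_imp_0 by auto
next
  case (Suc m)
  let ?x = "\<lambda>i. c (i, N - ord i)"
  obtain i0 where i0: "i0 \<in> {1..n}" "?x i0 \<noteq> 0"
    using relation_lower[of 0 c] relation_0_imp_0[of c w0] c c0 by auto
  obtain q where q: "\<forall>i\<in>{1..n}. b (i, N - ord i + m) = q * ?x i"
  proof (rule left_kernel_one_dimensional[of "{1..n}" "{1..n-1}" "\<lambda>i j. h i (j, ord i)" ?x i0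
        "\<lambda>i. b (i, N - ord i + m)"])
    show "\<forall>j\<in>{1..n-1}. (\<Sum>i\<in>{1..n}. ?x i * h i (j, ord i)) = 0"
      using relation_top_in_left_kernel[of 0 c] c by simp
    show "\<forall>j\<in>{1..n-1}. (\<Sum>i\<in>{1..n}. b (i, N - ord i + m) * h i (j, ord i)) = 0"
      by (rule relation_top_in_left_kernel[OF Suc.prems])
  qed (use n symbol_injective i0 in auto)
  define b' where "b' w = b w - q * (form_deriv d ^^ m) c w" for w
  have "relation (Suc m) b'"
    unfolding b'_def using relation_diff[OF Suc.prems] relation_deriv_pow[OF c, of m] by simp
  moreover have "b' (i, N - ord i + m) = 0" if "i \<in> {1..n}" for i
  proof -
    have "c (i, k) = 0" if "k > N - ord i" for k
      by (rule relation_support[OF c]) (use that in \<open>auto simp: window_def\<close>)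
    then have "(form_deriv d ^^ m) c (i, N - ord i + m) = ?x i"
      using form_deriv_pow_top[OF d] by blast
    then show ?thesis using q that by (simp add: b'_def)
  qed
  ultimately have "relation m b'" by (rule relation_lower)
  from Suc.IH[OF this] obtain p where p: "\<forall>w. b' w = (\<Sum>t<m. p t * (form_deriv d ^^ t) c w)" by blast
  have "b w = (\<Sum>t<Suc m. (p(m := q)) t * (form_deriv d ^^ t) c w)" for w
  proof -
    have "b w = b' w + q * (form_deriv d ^^ m) c w" by (simp add: b'_def)
    then show ?thesis using p by simp
  qed
  then show ?case by blast
qed

text \<open>
A relation supported on \<open>W\<close> is a combination of derivatives of \<open>c\<close>.  If \<open>t\<close> is the highest order of
derivative that occurs, the combination has at \<open>(i0, k0 + t)\<close> a nonzero multiple of \<open>c (i0, k0)\<close>,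
but that position is not in \<open>W\<close>.
\<close>

lemma forms_independent:
  assumes c: "relation 1 c" and ck: "c (i0, k0) \<noteq> 0" and c0: "\<And>k. k > k0 \<Longrightarrow> c (i0, k) = 0"
    and W: "finite W" "W \<subseteq> {1..n} \<times> UNIV" and Wk: "\<And>k. k \<ge> k0 \<Longrightarrow> (i0, k) \<notin> W"
    and b: "\<And>v. (\<Sum>w\<in>W. b w * form w v) = 0"
  shows "\<forall>w\<in>W. b w = 0"
proof -
  define m where "m = Suc (Max (insert 0 (snd ` W)))"
  define b' where "b' w = (if w \<in> W then b w else 0)" for w
  have "snd w < m" if "w \<in> W" for w
    using that W(1) by (auto simp: m_def less_Suc_eq_le intro!: Max_ge)
  then have Wm: "W \<subseteq> window m" using W(2) by (auto simp: window_def) (metis snd_conv trans_less_add2)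
  have "(\<Sum>w\<in>window m. b' w * form w v) = (\<Sum>w\<in>W. b w * form w v)" for v
    by (rule sum.mono_neutral_cong_right) (use Wm in \<open>auto simp: b'_def\<close>)
  then have "relation m b'" using b Wm by (intro relationI) (auto simp: b'_def)
  then obtain q where q: "\<And>w. b' w = (\<Sum>t<m. q t * (form_deriv d ^^ t) c w)"
    using relation_generated[OF c ck] by blast
  have "q t = 0" if "t < m" for t
  proof (rule ccontr)
    assume qt: "q t \<noteq> 0"
    define T where "T = {t. t < m \<and> q t \<noteq> 0}"
    define t where "t = Max T"
    have T: "finite T" "T \<noteq> {}" using qt that by (auto simp: T_def)
    have t: "t < m" "q t \<noteq> 0" using Max_in[OF T] by (auto simp: T_def t_def)
    have tmax: "q s = 0" if "s < m" "s > t" for s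
      using Max_ge[OF T(1), of s] that by (cases "s \<in> T") (auto simp: t_def, auto simp: T_def)
    have "q s * (form_deriv d ^^ s) c (i0, k0 + t) = (if s = t then q t * c (i0, k0) else 0)"
      if "s < m" for s
      using form_deriv_pow_top[of d k0 c i0 s, OF d c0] tmax[OF that] by (cases s t rule: linorder_cases) auto
    then have "b' (i0, k0 + t) = (\<Sum>s<m. if s = t then q t * c (i0, k0) else 0)"
      unfolding q by (intro sum.cong) auto
    also have "\<dots> = q t * c (i0, k0)" using t by simp
    finally show False using t ck Wk[of "k0 + t"] by (simp add: b'_def)
  qed
  then have "b' w = 0" for w unfolding q by simp
  then show ?thesis unfolding b'_def by metis
qed

text \<open>
There are \<open>n\<close> rows of the symbol matrix and only \<open>n - 1\<close> columns, so a nonzero \<open>x\<close> is orthogonal to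
all columns.  The witness \<open>e\<close> is the unit vector at the top row of an \<open>i0\<close> with \<open>x i0 \<noteq> 0\<close>: the rows
of window 0 force the unknowns of order below \<open>N\<close> to vanish, pairing the top rows with \<open>x\<close> removes
\<open>s\<close>, and injectivity of the symbol removes the rest.
\<close>

lemma bordered_columns_independent:
  obtains e :: "dvar \<Rightarrow> 'a" where
    "\<And>y s. \<forall>w\<in>window 1. (\<Sum>v\<in>{1..n-1} \<times> {..<Suc N}. form w v * y v) + e w * s = 0 \<Longrightarrow>
       s = 0 \<and> (\<forall>v\<in>{1..n-1} \<times> {..<Suc N}. y v = 0)"
proof -
  obtain x i0 where x: "\<forall>j\<in>{1..n-1}. (\<Sum>i\<in>{1..n}. x i * h i (j, ord i)) = 0"
    and i0: "i0 \<in> {1..n}" "x i0 \<noteq> 0"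
    by (rule left_kernel_nontrivial[of "{1..n}" "{1..n-1}" "\<lambda>i j. h i (j, ord i)"]) (use n in auto)
  define e where "e w = (if w = (i0, N - ord i0) then 1 else (0::'a))" for w
  have "s = 0 \<and> (\<forall>v\<in>{1..n-1} \<times> {..<Suc N}. y v = 0)"
    if eq: "\<forall>w\<in>window 1. (\<Sum>v\<in>{1..n-1} \<times> {..<Suc N}. form w v * y v) + e w * s = 0" for y s
  proof -
    have split: "(\<Sum>v\<in>{1..n-1} \<times> {..<Suc N}. form w v * y v)
      = (\<Sum>v\<in>{1..n-1} \<times> {..<N}. form w v * y v) + (\<Sum>j\<in>{1..n-1}. form w (j, N) * y (j, N))" for w
      by (simp only: sum.cartesian_product' sum.lessThan_Suc sum.distrib)
    have "(\<Sum>v\<in>{1..n-1} \<times> {..<N}. form w v * y v) = 0" if w0: "w \<in> window 0" for w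
    proof -
      obtain i k where w: "w = (i, k)" "i \<in> {1..n}" "k < N - ord i"
        using w0 by (auto simp: window_def)
      have "form w (j, N) = 0" for j
        using form_support(2)[OF w(2), of k j N] w ord_le[OF w(2)] by force
      moreover have "e w = 0" using w by (auto simp: e_def)
      moreover have "w \<in> window 1" using w0 window_mono[of 0 1] by auto
      ultimately show ?thesis using eq split[of w] by force
    qed
    then have low: "\<forall>v\<in>{1..n-1} \<times> {..<N}. y v = 0"
      using columns_independent[of y] by (simp add: form_def window_def)
    have top: "(\<Sum>j\<in>{1..n-1}. h i (j, ord i) * y (j, N)) + (if i = i0 then s else 0) = 0"
      if i: "i \<in> {1..n}" for i
    proof -
      have "form (i, N - ord i) (j, N) = h i (j, ord i)" for j
        using form_top[OF i, of "N - ord i" j] ord_le[OF i] by simp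
      moreover have "(i, N - ord i) \<in> window 1" using i by (auto simp: window_def)
      moreover have "(\<Sum>v\<in>{1..n-1} \<times> {..<N}. form w v * y v) = 0" for w
        using low by (intro sum.neutral) auto
      ultimately show ?thesis using eq split[of "(i, N - ord i)"] by (auto simp: e_def split: if_splits)
    qed
    have "0 = (\<Sum>i\<in>{1..n}. x i * ((\<Sum>j\<in>{1..n-1}. h i (j, ord i) * y (j, N)) + (if i = i0 then s else 0)))"
      using top by simp
    also have "\<dots> = (\<Sum>i\<in>{1..n}. \<Sum>j\<in>{1..n-1}. x i * h i (j, ord i) * y (j, N))
        + (\<Sum>i\<in>{1..n}. if i = i0 then x i0 * s else 0)"
      unfolding distrib_left sum.distrib sum_distrib_left mult.assoc
      by (intro arg_cong2[where f = "(+)"] refl sum.cong) auto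
    also have "(\<Sum>i\<in>{1..n}. \<Sum>j\<in>{1..n-1}. x i * h i (j, ord i) * y (j, N))
      = (\<Sum>j\<in>{1..n-1}. (\<Sum>i\<in>{1..n}. x i * h i (j, ord i)) * y (j, N))"
      by (subst sum.swap) (simp add: sum_distrib_right)
    also have "\<dots> = 0" using x by simp
    also have "(\<Sum>i\<in>{1..n}. if i = i0 then x i0 * s else 0) = x i0 * s" using i0(1) by simp
    finally have s: "s = 0" using i0(2) by simp
    then have "\<forall>i\<in>{1..n}. (\<Sum>j\<in>{1..n-1}. h i (j, ord i) * y (j, N)) = 0" using top by fastforce
    then have "\<forall>j\<in>{1..n-1}. y (j, N) = 0" by (rule symbol_injective)
    with low s show ?thesis by (auto simp: less_Suc_eq)
  qed
  from that[OF this] show thesis .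
qed

end

section \<open>Evaluation of polynomials\<close>

lemma comm_ring_hom_dconst: "comm_ring_hom (dconst :: 'a::comm_ring_1 \<Rightarrow> 'a dpoly)"
  by unfold_locales (simp_all add: dconst_def single_add mult_single)

lemma dconst_0 [simp]: "dconst 0 = 0"
  by (simp add: dconst_def)

lemma vmon_eq_iff [simp]: "vmon u = vmon v \<longleftrightarrow> u = v"
proof
  assume "vmon u = vmon v"
  then have "Poly_Mapping.keys (vmon u) = Poly_Mapping.keys (vmon v)" by simp
  then show "u = v" by (simp add: vmon_def)
qed simp

lemma vmon_neq_0 [simp]: "vmon v \<noteq> 0" "0 \<noteq> vmon v"
proof -
  have "Poly_Mapping.keys (vmon v) \<noteq> Poly_Mapping.keys 0" by (simp add: vmon_def)
  then show "vmon v \<noteq> 0" "0 \<noteq> vmon v" by auto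
qed

lemma keys_vmon [simp]: "Poly_Mapping.keys (vmon v) = {v}"
  by (simp add: vmon_def)

lemma poly_mapping_sum_singles:
  assumes "finite M" "Poly_Mapping.keys p \<subseteq> M"
  shows "(\<Sum>m\<in>M. Poly_Mapping.single m (Poly_Mapping.lookup p m)) = p"
proof (rule poly_mapping_eqI)
  fix k
  have "Poly_Mapping.lookup (\<Sum>m\<in>M. Poly_Mapping.single m (Poly_Mapping.lookup p m)) k
    = (\<Sum>m\<in>M. if m = k then Poly_Mapping.lookup p k else 0)"
    by (auto simp: lookup_sum lookup_single when_def intro!: sum.cong)
  also have "\<dots> = Poly_Mapping.lookup p k"
    using assms by (auto simp: in_keys_iff)
  finally show "Poly_Mapping.lookup (\<Sum>m\<in>M. Poly_Mapping.single m (Poly_Mapping.lookup p m)) k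
    = Poly_Mapping.lookup p k" .
qed

definition mon_eval :: "(dvar \<Rightarrow> 'b::comm_ring_1) \<Rightarrow> dmon \<Rightarrow> 'b" where
  "mon_eval g m = (\<Prod>v\<in>Poly_Mapping.keys m. g v ^ Poly_Mapping.lookup m v)"

definition poly_eval :: "('a::comm_ring_1 \<Rightarrow> 'b::comm_ring_1) \<Rightarrow> (dvar \<Rightarrow> 'b) \<Rightarrow> 'a dpoly \<Rightarrow> 'b" where
  "poly_eval h g p = (\<Sum>m\<in>Poly_Mapping.keys p. h (Poly_Mapping.lookup p m) * mon_eval g m)"

lemma mon_eval_superset:
  assumes "finite V" "Poly_Mapping.keys m \<subseteq> V"
  shows "mon_eval g m = (\<Prod>v\<in>V. g v ^ Poly_Mapping.lookup m v)"
  unfolding mon_eval_def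
  by (rule prod.mono_neutral_left) (use assms in \<open>auto simp: in_keys_iff\<close>)

lemma mon_eval_add: "mon_eval g (m + m') = mon_eval g m * mon_eval g m'"
proof -
  let ?V = "Poly_Mapping.keys m \<union> Poly_Mapping.keys m'"
  have "mon_eval g (m + m') = (\<Prod>v\<in>?V. g v ^ Poly_Mapping.lookup (m + m') v)"
    by (rule mon_eval_superset) (use keys_add[of m m'] in auto)
  then show ?thesis
    by (simp add: mon_eval_superset[of ?V m] mon_eval_superset[of ?V m'] lookup_add power_add prod.distrib)
qed

lemma mon_eval_0 [simp]: "mon_eval g 0 = 1"
  by (simp add: mon_eval_def)

lemma mon_eval_vmon [simp]: "mon_eval g (vmon v) = g v"
  by (simp add: mon_eval_def) (simp add: vmon_def)

lemma mon_eval_dvariable: "mon_eval dvariable m = (Poly_Mapping.single m 1 :: 'a::comm_ring_1 dpoly)"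
proof -
  have pow: "dvariable v ^ e = (Poly_Mapping.single (Poly_Mapping.single v e) 1 :: 'a dpoly)" for v e
    by (induction e) (simp_all add: dvariable_def vmon_def mult_single single_add[symmetric] add.commute)
  have "(\<Prod>v\<in>V. Poly_Mapping.single (g v) 1) = (Poly_Mapping.single (\<Sum>v\<in>V. g v) 1 :: 'a dpoly)"
    for V :: "dvar set" and g :: "dvar \<Rightarrow> dmon"
    by (induction V rule: infinite_finite_induct) (simp_all add: mult_single)
  then show ?thesis
    by (simp add: mon_eval_def pow poly_mapping_sum_singles)
qed

context comm_ring_hom
begin

lemma poly_eval_single: "poly_eval hom g (Poly_Mapping.single m c) = hom c * mon_eval g m"
  by (simp add: poly_eval_def)

lemma poly_eval_0: "poly_eval hom g 0 = 0"
  by (simp add: poly_eval_def)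

lemma poly_eval_add: "poly_eval hom g (p + q) = poly_eval hom g p + poly_eval hom g q"
  unfolding poly_eval_def
  by (rule setsum_keys_plus_distrib[of "\<lambda>m c. hom c * mon_eval g m"])
    (simp_all add: hom_add distrib_right)

lemma poly_eval_sum: "poly_eval hom g (\<Sum>x\<in>A. f x) = (\<Sum>x\<in>A. poly_eval hom g (f x))"
  by (induction A rule: infinite_finite_induct) (simp_all add: poly_eval_0 poly_eval_add)

lemma poly_eval_mult: "poly_eval hom g (p * q) = poly_eval hom g p * poly_eval hom g q"
proof -
  let ?s = "\<lambda>p m. Poly_Mapping.single m (Poly_Mapping.lookup p m)"
  have "p * q = (\<Sum>m\<in>Poly_Mapping.keys p. ?s p m) * (\<Sum>m\<in>Poly_Mapping.keys q. ?s q m)"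
    by (simp add: poly_mapping_sum_singles)
  also have "poly_eval hom g \<dots> = poly_eval hom g p * poly_eval hom g q"
    by (simp add: sum_product poly_eval_sum mult_single poly_eval_single mon_eval_add hom_mult)
      (simp add: poly_eval_def sum_product mult_ac)
  finally show ?thesis .
qed

lemma comm_ring_hom_poly_eval: "comm_ring_hom (poly_eval hom g)"
  by unfold_locales
    (simp_all add: poly_eval_0 poly_eval_add poly_eval_mult poly_eval_single single_one[symmetric] del: single_one)

end

lemma (in comm_ring_hom) poly_eval_dconst: "poly_eval hom g (dconst c) = hom c"
  by (simp add: dconst_def poly_eval_single)

lemma (in comm_ring_hom) poly_eval_dvariable_hom: "poly_eval hom g (dvariable v) = g v"
  by (simp add: dvariable_def poly_eval_single)

lemma poly_eval_cong:
  assumes "\<And>v. v \<in> dvars p \<Longrightarrow> g v = g' v"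
  shows "poly_eval h g p = poly_eval h g' p"
proof -
  have "mon_eval g m = mon_eval g' m" if "m \<in> Poly_Mapping.keys p" for m
    unfolding mon_eval_def
    by (intro prod.cong refl arg_cong2[where f = "(^)"] assms) (use that in \<open>auto simp: dvars_def\<close>)
  then show ?thesis by (simp add: poly_eval_def)
qed

lemma poly_eval_dvariable: "poly_eval dconst dvariable p = (p :: 'a::comm_ring_1 dpoly)"
  by (simp add: poly_eval_def mon_eval_dvariable dconst_def mult_single poly_mapping_sum_singles)

lemma poly_eval_compose:
  fixes p :: "'a::comm_ring_1 dpoly"
  assumes "comm_ring_hom F" "comm_ring_hom h"
  shows "F (poly_eval h g p) = poly_eval (F \<circ> h) (F \<circ> g) p"
proof -
  interpret F: comm_ring_hom F by (rule assms(1))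
  show ?thesis
    by (simp add: poly_eval_def mon_eval_def F.hom_sum F.hom_mult F.hom_prod F.hom_power)
qed

lemma dsubst_eq_poly_eval:
  "dsubst d P = poly_eval dconst (\<lambda>v. (dderiv d ^^ snd v) (P (fst v)))"
  by (simp add: fun_eq_iff dsubst_def poly_eval_def mon_eval_def)

section \<open>Polynomials of degree at most one\<close>

text \<open>
The polynomial with constant term \<open>c\<close> and linear part \<open>f\<close>.  Keeping \<open>f\<close> as a function reduces
identities between such polynomials to identities between linear forms.
\<close>

definition is_affine :: "'a::comm_ring_1 dpoly \<Rightarrow> 'a \<Rightarrow> (dvar \<Rightarrow> 'a) \<Rightarrow> bool" where
  "is_affine p c f \<longleftrightarrow> Poly_Mapping.lookup p 0 = c \<and> (\<forall>v. Poly_Mapping.lookup p (vmon v) = f v) \<and>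
     (\<forall>m. m \<noteq> 0 \<longrightarrow> m \<notin> range vmon \<longrightarrow> Poly_Mapping.lookup p m = 0)"

lemma is_affine_lookup: "is_affine p c f \<Longrightarrow> Poly_Mapping.lookup p 0 = c"
  "is_affine p c f \<Longrightarrow> Poly_Mapping.lookup p (vmon v) = f v"
  by (simp_all only: is_affine_def)

lemma is_affine_unique: "is_affine p c f \<Longrightarrow> is_affine q c f \<Longrightarrow> p = q"
  unfolding is_affine_def by (intro poly_mapping_eqI) (metis rangeE)

lemma is_affine_finite: "is_affine p c f \<Longrightarrow> finite {v. f v \<noteq> 0}"
proof -
  assume "is_affine p c f"
  then have "vmon ` {v. f v \<noteq> 0} \<subseteq> Poly_Mapping.keys p"
    by (auto simp: is_affine_def in_keys_iff)
  then have "finite (vmon ` {v. f v \<noteq> 0})" by (rule finite_subset) simp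
  then show ?thesis by (rule finite_imageD) (simp add: inj_on_def)
qed

lemma is_affine_dconst: "is_affine (dconst c) c (\<lambda>_. 0)"
  by (auto simp: is_affine_def dconst_def lookup_single when_def)

lemma is_affine_single: "is_affine (Poly_Mapping.single (vmon u) c) 0 (\<lambda>v. if v = u then c else 0)"
  by (auto simp: is_affine_def lookup_single when_def)

lemma is_affine_dvariable: "is_affine (dvariable u) 0 (\<lambda>v. if v = u then 1 else 0)"
  unfolding dvariable_def by (rule is_affine_single)

lemma is_affine_add: "is_affine p c f \<Longrightarrow> is_affine q b g \<Longrightarrow> is_affine (p + q) (c + b) (\<lambda>v. f v + g v)"
  by (simp add: is_affine_def lookup_add)

lemma is_affine_diff: "is_affine p c f \<Longrightarrow> is_affine q b g \<Longrightarrow> is_affine (p - q) (c - b) (\<lambda>v. f v - g v)"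
  by (simp add: is_affine_def lookup_minus)

lemma is_affine_sum:
  assumes "\<And>x. x \<in> A \<Longrightarrow> is_affine (p x) (c x) (f x)"
  shows "is_affine (\<Sum>x\<in>A. p x) (\<Sum>x\<in>A. c x) (\<lambda>v. \<Sum>x\<in>A. f x v)"
  using assms by (simp add: is_affine_def lookup_sum)

lemma is_affine_scale: "is_affine p c f \<Longrightarrow> is_affine (dconst b * p) (b * c) (\<lambda>v. b * f v)"
proof -
  have "Poly_Mapping.lookup (dconst b * p) m = b * Poly_Mapping.lookup p m" for m
    unfolding dconst_def mult_map_scale_conv_mult[symmetric] by (simp add: Poly_Mapping.map.rep_eq when_def)
  then show "is_affine p c f \<Longrightarrow> ?thesis" by (simp add: is_affine_def)
qed

lemma is_affine_expand:
  assumes "is_affine p c f" "finite V" "\<And>v. v \<notin> V \<Longrightarrow> f v = 0"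
  shows "p = dconst c + (\<Sum>v\<in>V. Poly_Mapping.single (vmon v) (f v))"
proof (rule is_affine_unique[OF assms(1)])
  have "is_affine (dconst c + (\<Sum>v\<in>V. Poly_Mapping.single (vmon v) (f v)))
     (c + (\<Sum>v\<in>V. 0)) (\<lambda>u. 0 + (\<Sum>v\<in>V. if u = v then f v else 0))"
    by (intro is_affine_add is_affine_dconst is_affine_sum is_affine_single)
  then show "is_affine (dconst c + (\<Sum>v\<in>V. Poly_Mapping.single (vmon v) (f v))) c f"
    using assms(2,3) by (simp add: is_affine_def)
qed

lemma is_affine_eval:
  assumes "is_affine p c f" "finite V" "\<And>v. v \<notin> V \<Longrightarrow> f v = 0" "comm_ring_hom h"
  shows "poly_eval h g p = h c + (\<Sum>v\<in>V. h (f v) * g v)"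
proof -
  interpret comm_ring_hom h by (rule assms(4))
  have "poly_eval h g p = poly_eval h g (dconst c + (\<Sum>v\<in>V. Poly_Mapping.single (vmon v) (f v)))"
    by (rule arg_cong[OF is_affine_expand[OF assms(1-3)]])
  also have "\<dots> = h c + (\<Sum>v\<in>V. h (f v) * g v)"
    by (simp only: poly_eval_add poly_eval_sum dconst_def poly_eval_single mon_eval_0 mon_eval_vmon mult_1_right)
  finally show ?thesis .
qed

lemma is_affine_dvars: "is_affine p c f \<Longrightarrow> dvars p = {v. f v \<noteq> 0}"
proof (intro equalityI subsetI)
  fix v assume p: "is_affine p c f" and "v \<in> dvars p"
  then obtain m where m: "Poly_Mapping.lookup p m \<noteq> 0" "v \<in> Poly_Mapping.keys m"
    by (auto simp: dvars_def in_keys_iff)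
  then have "m \<in> range vmon" using p by (metis is_affine_def empty_iff keys_zero)
  then show "v \<in> {v. f v \<noteq> 0}" using m p by (auto simp: is_affine_def)
next
  fix v assume p: "is_affine p c f" and "v \<in> {v. f v \<noteq> 0}"
  then have "vmon v \<in> Poly_Mapping.keys p" by (simp add: is_affine_lookup in_keys_iff)
  then show "v \<in> dvars p" by (force simp: dvars_def)
qed

section \<open>The derivation on polynomials of degree at most one\<close>

definition term_deriv :: "('a::comm_ring_1 \<Rightarrow> 'a) \<Rightarrow> dmon \<Rightarrow> 'a \<Rightarrow> 'a dpoly" where
  "term_deriv d m c = Poly_Mapping.single m (d c) +
     (\<Sum>v\<in>Poly_Mapping.keys m.
        Poly_Mapping.single (m - vmon v + vmon (dnext v)) (of_nat (Poly_Mapping.lookup m v) * c))"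

lemma dderiv_eq_sum_term_deriv:
  "dderiv d p = (\<Sum>m\<in>Poly_Mapping.keys p. term_deriv d m (Poly_Mapping.lookup p m))"
  by (simp add: dderiv_def term_deriv_def)

lemma term_deriv_add:
  assumes "additive d"
  shows "term_deriv d m (a + b) = term_deriv d m a + term_deriv d m b"
  by (simp add: term_deriv_def additive.add[OF assms] single_add distrib_left sum.distrib algebra_simps)

lemma term_deriv_0: "additive d \<Longrightarrow> term_deriv d m 0 = 0"
  by (simp add: term_deriv_def additive.zero)

lemma additive_dderiv:
  assumes "additive d"
  shows "additive (dderiv d)"
proof
  show "dderiv d (p + q) = dderiv d p + dderiv d q" for p q
    unfolding dderiv_eq_sum_term_deriv
    by (rule setsum_keys_plus_distrib) (simp_all add: term_deriv_0 term_deriv_add assms)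
qed

lemma additive_pow: "additive f \<Longrightarrow> additive (f ^^ k)" for f :: "'b::ab_group_add \<Rightarrow> 'b"
  by (induction k) (auto simp: additive_def)

lemma dderiv_single: "additive d \<Longrightarrow> dderiv d (Poly_Mapping.single m c) = term_deriv d m c"
  by (simp add: dderiv_eq_sum_term_deriv term_deriv_0)

lemma dderiv_dconst: "additive d \<Longrightarrow> dderiv d (dconst c) = dconst (d c)"
  by (simp add: dconst_def dderiv_single term_deriv_def)

lemma dderiv_single_vmon:
  "additive d \<Longrightarrow> dderiv d (Poly_Mapping.single (vmon v) c)
     = Poly_Mapping.single (vmon v) (d c) + Poly_Mapping.single (vmon (dnext v)) c"
  by (simp add: dderiv_single term_deriv_def) (simp add: vmon_def)

lemma is_affine_dderiv:
  assumes d: "additive d" and p: "is_affine p c f"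
  shows "is_affine (dderiv d p) (d c) (form_deriv d f)"
proof -
  define V where "V = {v. f v \<noteq> 0}"
  have V: "finite V" "\<And>v. v \<notin> V \<Longrightarrow> f v = 0" using is_affine_finite[OF p] by (auto simp: V_def)
  interpret D: additive "dderiv d" by (rule additive_dderiv[OF d])
  have "dderiv d p = dconst (d c) + (\<Sum>v\<in>V. Poly_Mapping.single (vmon v) (d (f v))
      + Poly_Mapping.single (vmon (dnext v)) (f v))"
    by (subst is_affine_expand[OF p V])
      (simp_all add: D.add D.sum dderiv_dconst[OF d] dderiv_single_vmon[OF d])
  moreover have "is_affine (dconst (d c) + (\<Sum>v\<in>V. Poly_Mapping.single (vmon v) (d (f v))
      + Poly_Mapping.single (vmon (dnext v)) (f v))) (d c + (\<Sum>v\<in>V. 0 + 0))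
     (\<lambda>u. 0 + (\<Sum>v\<in>V. (if u = v then d (f v) else 0) + (if u = dnext v then f v else 0)))"
    by (intro is_affine_add is_affine_dconst is_affine_sum is_affine_single)
  moreover have "0 + (\<Sum>v\<in>V. (if u = v then d (f v) else 0) + (if u = dnext v then f v else 0))
      = form_deriv d f u" for u
  proof -
    have "(\<Sum>v\<in>V. if u = v then d (f v) else 0) = d (f u)"
      using V additive.zero[OF d] by auto
    moreover have "(\<Sum>v\<in>V. if u = dnext v then f v else 0)
        = (case snd u of 0 \<Rightarrow> 0 | Suc k \<Rightarrow> f (fst u, k))"
    proof (cases "snd u")
      case 0
      then show ?thesis by (auto simp: dnext_def intro!: sum.neutral)
    next
      case (Suc k)
      then have "(\<Sum>v\<in>V. if u = dnext v then f v else 0) = (\<Sum>v\<in>V. if (fst u, k) = v then f v else 0)"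
        by (intro sum.cong) (auto simp: dnext_def prod_eq_iff)
      then show ?thesis using Suc V by auto
    qed
    ultimately show ?thesis by (simp add: form_deriv_def sum.distrib)
  qed
  ultimately show ?thesis by simp
qed

lemma is_affine_dderiv_pow:
  assumes "additive d" "is_affine p c f"
  shows "is_affine ((dderiv d ^^ k) p) ((d ^^ k) c) ((form_deriv d ^^ k) f)"
  by (induction k) (simp_all add: assms is_affine_dderiv)

section \<open>Algebraic independence and irreducibility\<close>

lemma finite_dvars [simp]: "finite (dvars p)"
  by (simp add: dvars_def)

text \<open>
A system of functionals dual to the linear parts defines a substitution \<open>\<rho>\<close> that sends each \<open>g w\<close>
back to the variable \<open>w\<close>.  It is a ring homomorphism, so it maps the value 0 of \<open>p\<close> at \<open>g\<close> to
\<open>p\<close> itself.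
\<close>

lemma affine_substitution_injective:
  fixes p :: "'a::field dpoly"
  assumes aff: "\<And>w. w \<in> dvars p \<Longrightarrow> is_affine (g w) (\<alpha> w) (f w)"
    and indep: "\<And>b. \<forall>v. (\<Sum>w\<in>dvars p. b w * f w v) = 0 \<Longrightarrow> \<forall>w\<in>dvars p. b w = 0"
    and zero: "poly_eval dconst g p = 0"
  shows "p = 0"
proof -
  let ?W = "dvars p"
  interpret dc: comm_ring_hom "dconst :: 'a \<Rightarrow> 'a dpoly" by (rule comm_ring_hom_dconst)
  define V where "V = (\<Union>w\<in>?W. {v. f w v \<noteq> 0})"
  have V: "finite V" using is_affine_finite[OF aff] by (simp add: V_def)
  have fV: "f w v = 0" if "w \<in> ?W" "v \<notin> V" for w v using that by (auto simp: V_def)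
  have "\<forall>w\<in>?W. b w = 0" if b: "\<forall>v\<in>V. (\<Sum>w\<in>?W. b w * f w v) = 0" for b
  proof (rule indep, rule allI)
    fix v
    show "(\<Sum>w\<in>?W. b w * f w v) = 0"
      using b fV by (cases "v \<in> V") (simp_all add: sum.neutral)
  qed
  from dual_family_exists[OF finite_dvars V this] obtain y
    where y: "\<And>w w'. w \<in> ?W \<Longrightarrow> w' \<in> ?W \<Longrightarrow> (\<Sum>v\<in>V. f w' v * y w v) = (if w = w' then 1 else 0)"
    by blast
  define \<rho> where "\<rho> v = (\<Sum>w\<in>?W. dconst (y w v) * (dvariable w - dconst (\<alpha> w)))" for v
  interpret \<rho>: comm_ring_hom "poly_eval dconst \<rho>" by (rule dc.comm_ring_hom_poly_eval)
  have "poly_eval dconst \<rho> (g w) = dvariable w" if w: "w \<in> ?W" for w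
  proof -
    have "poly_eval dconst \<rho> (g w) = dconst (\<alpha> w) + (\<Sum>v\<in>V. dconst (f w v) * \<rho> v)"
      by (rule is_affine_eval[OF aff[OF w] V fV[OF w] comm_ring_hom_dconst])
    also have "(\<Sum>v\<in>V. dconst (f w v) * \<rho> v)
      = (\<Sum>w'\<in>?W. dconst (\<Sum>v\<in>V. f w v * y w' v) * (dvariable w' - dconst (\<alpha> w')))"
      unfolding \<rho>_def sum_distrib_left dc.hom_sum sum_distrib_right dc.hom_mult
      by (subst sum.swap) (simp only: mult.assoc)
    also have "\<dots> = (\<Sum>w'\<in>?W. if w' = w then dvariable w - dconst (\<alpha> w) else 0)"
      using y w by (intro sum.cong) auto
    also have "\<dots> = dvariable w - dconst (\<alpha> w)" using w by simp
    finally show ?thesis by simp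
  qed
  then have "p = poly_eval dconst (poly_eval dconst \<rho> \<circ> g) p"
    by (subst poly_eval_dvariable[of p, symmetric], intro poly_eval_cong) simp
  also have "\<dots> = poly_eval (poly_eval dconst \<rho> \<circ> dconst) (poly_eval dconst \<rho> \<circ> g) p"
  proof -
    have "poly_eval dconst \<rho> \<circ> dconst = (dconst :: 'a \<Rightarrow> _)"
      by (simp add: fun_eq_iff dc.poly_eval_dconst)
    then show ?thesis by simp
  qed
  also have "\<dots> = poly_eval dconst \<rho> (poly_eval dconst g p)"
    by (rule poly_eval_compose[symmetric, OF \<rho>.comm_ring_hom_axioms comm_ring_hom_dconst])
  also have "\<dots> = 0" using zero by simp
  finally show ?thesis .
qed

lemma sum_const_poly: "(\<Sum>x\<in>A. [:f x:]) = [:\<Sum>x\<in>A. f x:]"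
  by (induction A rule: infinite_finite_induct) simp_all

text \<open>
Regard polynomials as univariate in \<open>v\<close> over the integral domain of all polynomials: \<open>p\<close> has degree
one with a leading coefficient in the field, so one of two factors has degree 0 and divides that
leading coefficient.
\<close>

lemma affine_irreducible:
  fixes p :: "'a::field dpoly"
  assumes p: "is_affine p c f" and v: "f v \<noteq> 0"
  shows "irreducible p"
proof -
  define h where "h c = [:dconst c:]" for c :: 'a
  define g where "g w = (if w = v then [:0, 1:] else ([:dvariable w:] :: 'a dpoly poly))" for w
  interpret dc: comm_ring_hom "dconst :: 'a \<Rightarrow> 'a dpoly" by (rule comm_ring_hom_dconst)
  interpret h: comm_ring_hom h
    by unfold_locales (simp_all add: h_def dc.hom_add dc.hom_mult one_pCons)
  interpret \<Phi>: comm_ring_hom "poly_eval h g" by (rule h.comm_ring_hom_poly_eval)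
  define F where "F q = poly q (dvariable v)" for q :: "'a dpoly poly"
  interpret F: comm_ring_hom F by unfold_locales (simp_all add: F_def)
  \<comment> \<open>Inserting \<open>v\<close> again inverts the passage to univariate polynomials.\<close>
  have retract: "F (poly_eval h g q) = q" for q
  proof -
    have "F (poly_eval h g q) = poly_eval (F \<circ> h) (F \<circ> g) q"
      by (rule poly_eval_compose) unfold_locales
    also have "F \<circ> h = dconst" by (simp add: fun_eq_iff F_def h_def)
    also have "F \<circ> g = dvariable" by (simp add: fun_eq_iff F_def g_def)
    finally show ?thesis by (simp add: poly_eval_dvariable)
  qed
  define V where "V = {w. f w \<noteq> 0}"
  have V: "finite V" "\<And>w. w \<notin> V \<Longrightarrow> f w = 0" "v \<in> V"
    using is_affine_finite[OF p] v by (auto simp: V_def)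
  obtain B where B: "poly_eval h g p = [:B, dconst (f v):]"
  proof -
    have "poly_eval h g p = h c + (\<Sum>w\<in>V. h (f w) * g w)"
      by (rule is_affine_eval[OF p V(1,2) h.comm_ring_hom_axioms])
    also have "(\<Sum>w\<in>V. h (f w) * g w) = h (f v) * g v + (\<Sum>w\<in>V - {v}. h (f w) * g w)"
      by (rule sum.remove[OF V(1,3)])
    also have "(\<Sum>w\<in>V - {v}. h (f w) * g w) = (\<Sum>w\<in>V - {v}. [:dconst (f w) * dvariable w:])"
      by (intro sum.cong) (auto simp: h_def g_def)
    also have "h c + (h (f v) * g v + (\<Sum>w\<in>V - {v}. [:dconst (f w) * dvariable w:]))
        = [:dconst c + (\<Sum>w\<in>V - {v}. dconst (f w) * dvariable w), dconst (f v):]"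
      by (simp add: sum_const_poly h_def g_def)
    finally show thesis by (rule that)
  qed
  have unit: "dconst (f v) dvd 1"
  proof
    show "1 = dconst (f v) * dconst (inverse (f v))"
      using v by (simp add: dc.hom_mult[symmetric])
  qed
  then have lead: "dconst (f v) \<noteq> 0" by auto
  have deg: "degree (poly_eval h g p) = 1" using lead by (simp add: B)
  have deg_mult: "degree (poly_eval h g a) + degree (poly_eval h g b) = degree (poly_eval h g (a * b))"
    if "a * b \<noteq> 0" for a b
  proof -
    have "poly_eval h g a \<noteq> 0" "poly_eval h g b \<noteq> 0"
      using retract[of a] retract[of b] that by auto
    then show ?thesis by (simp add: \<Phi>.hom_mult degree_mult_eq)
  qed
  have const_factor: "a dvd 1" if ab: "p = a * b" and a: "degree (poly_eval h g a) = 0" for a b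
  proof -
    obtain a' where a': "poly_eval h g a = [:a':]" using a by (rule degree_eq_zeroE)
    then have "a = a'" using retract[of a] by (simp add: F_def)
    moreover have "a' * coeff (poly_eval h g b) 1 = dconst (f v)"
    proof -
      have "coeff (poly_eval h g p) 1 = coeff ([:a':] * poly_eval h g b) 1"
        by (simp add: ab \<Phi>.hom_mult a')
      then show ?thesis by (simp add: B)
    qed
    ultimately show ?thesis using unit by (metis dvd_triv_left dvd_trans)
  qed
  have p0: "p \<noteq> 0" using deg by auto
  show ?thesis
  proof (rule irreducibleI[OF p0])
    show "\<not> p dvd 1"
    proof
      assume "p dvd 1"
      then obtain q where "1 = p * q" by (rule dvdE)
      then show False using deg_mult[of p q] deg by simp
    qed
  next
    fix a b assume ab: "p = a * b"
    then have "degree (poly_eval h g a) = 0 \<or> degree (poly_eval h g b) = 0"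
      using deg_mult[of a b] deg p0 by auto
    then show "a dvd 1 \<or> b dvd 1"
      using const_factor[OF ab] const_factor[of b a] ab by (auto simp: mult.commute)
  qed
qed

section \<open>The polynomials of a linear system of parametric equations\<close>

lemma derivation_additive: "derivation d \<Longrightarrow> additive d"
  by (simp add: derivation_def additive_def)

lemma dderiv_pow_dvariable:
  assumes "derivation d"
  shows "(dderiv d ^^ k) (dvariable (i, 0)) = dvariable (i, k)"
  by (induction k) (simp_all add: dvariable_def dderiv_single_vmon[OF derivation_additive[OF assms]]
      derivation_simps[OF assms] dnext_def)

lemma dderiv_pow_dconst: "additive d \<Longrightarrow> (dderiv d ^^ k) (dconst c) = dconst ((d ^^ k) c)"
  by (induction k) (simp_all add: dderiv_dconst)

lemma is_affine_dop_apply: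
  assumes "derivation d"
  shows "is_affine (dop_apply d L (dvariable (j, 0))) 0 (\<lambda>v. if fst v = j then coeff L (snd v) else 0)"
proof -
  have "is_affine (dop_apply d L (dvariable (j, 0))) (\<Sum>k\<le>degree L. coeff L k * 0)
     (\<lambda>v. \<Sum>k\<le>degree L. coeff L k * (if v = (j, k) then 1 else 0))"
    unfolding dop_apply_def dderiv_pow_dvariable[OF assms]
    by (intro is_affine_sum is_affine_scale is_affine_dvariable)
  moreover have "(\<Sum>k\<le>degree L. coeff L k * (if v = (j, k) then 1 else 0))
      = (if fst v = j then coeff L (snd v) else 0)" for v :: dvar
  proof (cases v)
    case (Pair i l)
    have "(\<Sum>k\<le>degree L. coeff L k * (if v = (j, k) then 1 else 0))
      = (\<Sum>k\<le>degree L. if k = l then (if i = j then coeff L l else 0) else 0)"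
      using Pair by (intro sum.cong) auto
    then show ?thesis using Pair by (auto simp: coeff_eq_0 not_le)
  qed
  ultimately show ?thesis by simp
qed

definition dppe_form :: "nat \<Rightarrow> (nat \<Rightarrow> nat \<Rightarrow> 'a::zero poly) \<Rightarrow> nat \<Rightarrow> dvar \<Rightarrow> 'a" where
  "dppe_form n L i v = (if fst v \<in> {1..n-1} then coeff (L i (fst v)) (snd v) else 0)"

lemma is_affine_dppe_H:
  assumes "derivation d"
  shows "is_affine (dppe_H d n L i) 0 (dppe_form n L i)"
proof -
  have "is_affine (dppe_H d n L i) (\<Sum>j\<in>{1..n-1}. 0)
     (\<lambda>v. \<Sum>j\<in>{1..n-1}. if fst v = j then coeff (L i j) (snd v) else 0)"
    unfolding dppe_H_def by (intro is_affine_sum is_affine_dop_apply[OF assms])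
  moreover have "(\<lambda>v. \<Sum>j\<in>{1..n-1}. if fst v = j then coeff (L i j) (snd v) else 0) = dppe_form n L i"
    by (auto simp: fun_eq_iff dppe_form_def)
  ultimately show ?thesis by simp
qed

lemma is_affine_map_dconst:
  "is_affine p c f \<Longrightarrow> is_affine (Poly_Mapping.map dconst p) (dconst c) (\<lambda>v. dconst (f v))"
  by (simp add: is_affine_def Poly_Mapping.map.rep_eq when_def)

lemma is_affine_dppe_F:
  assumes "derivation d"
  shows "is_affine (dppe_F d n a L i) (dvariable (i, 0) - dconst (a i)) (\<lambda>v. dconst (dppe_form n L i v))"
  using is_affine_add[OF is_affine_dconst is_affine_map_dconst[OF is_affine_dppe_H[OF assms]]]
  by (simp add: dppe_F_def)

lemma form_deriv_pow_dconst:
  assumes "additive d"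
  shows "(form_deriv (dderiv d) ^^ k) (\<lambda>v. dconst (f v)) = (\<lambda>v. dconst ((form_deriv d ^^ k) f v))"
proof -
  have "form_deriv (dderiv d) (\<lambda>v. dconst (g v)) = (\<lambda>v. dconst (form_deriv d g v))" for g :: "dvar \<Rightarrow> 'a"
  proof
    fix v
    show "form_deriv (dderiv d) (\<lambda>v. dconst (g v)) v = dconst (form_deriv d g v)"
      by (cases "snd v") (simp_all add: form_deriv_def dderiv_dconst[OF assms], simp add: dconst_def single_add)
  qed
  then show ?thesis by (induction k) simp_all
qed

lemma is_affine_deriv_dppe_F:
  assumes d: "derivation d"
  shows "is_affine ((dderiv (dderiv d) ^^ k) (dppe_F d n a L i))
    (dvariable (i, k) - dconst ((d ^^ k) (a i))) (\<lambda>v. dconst ((form_deriv d ^^ k) (dppe_form n L i) v))"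
proof -
  note add = derivation_additive[OF d]
  have "(dderiv d ^^ k) (dvariable (i, 0) - dconst (a i)) = dvariable (i, k) - dconst ((d ^^ k) (a i))"
    by (simp add: additive.diff[OF additive_pow[OF additive_dderiv[OF add]]]
        dderiv_pow_dvariable[OF d] dderiv_pow_dconst[OF add])
  with is_affine_dderiv_pow[OF additive_dderiv[OF add] is_affine_dppe_F[OF d, of n a L i], of k]
  show ?thesis by (simp add: form_deriv_pow_dconst[OF add])
qed

lemma dorder_affine:
  "is_affine p c f \<Longrightarrow> dorder p = (if \<forall>v. f v = 0 then 0 else Max (snd ` {v. f v \<noteq> 0}))"
  by (simp add: dorder_def is_affine_dvars)

lemma dorder_dppe_F:
  assumes "derivation d"
  shows "dorder (dppe_F d n a L i) = dorder (dppe_H d n L i)"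
proof -
  have "dconst x \<noteq> 0 \<longleftrightarrow> x \<noteq> 0" for x :: 'a
    by (metis dconst_0 dconst_def lookup_single_eq lookup_zero)
  then show ?thesis
    by (simp add: dorder_def is_affine_dvars[OF is_affine_dppe_H[OF assms]]
        is_affine_dvars[OF is_affine_dppe_F[OF assms]])
qed

text \<open>
Rows and columns of the resultant matrices are named by pairs, in the order of the matrices, so that
sums over matrix indices become sums over sets of pairs.
\<close>

definition row_index :: "(nat \<Rightarrow> nat) \<Rightarrow> nat \<Rightarrow> dvar list" where
  "row_index r n = concat (map (\<lambda>i. map (Pair i) (rev [0..<r i])) [1..<n+1])"

definition column_index :: "nat \<Rightarrow> nat \<Rightarrow> dvar list" where
  "column_index n K = concat (map (\<lambda>k. map (\<lambda>j. (j, k)) (rev [1..<n])) (rev [0..<K]))"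

lemma set_row_index: "set (row_index r n) = (SIGMA i:{1..n}. {..<r i})"
  by (auto simp: row_index_def)

lemma set_column_index: "set (column_index n K) = {1..n-1} \<times> {..<K}"
  by (force simp: column_index_def)

lemma distinct_concat_map:
  assumes "distinct xs" "\<And>i. distinct (ys i)" "\<And>i j x y. f i x = f j y \<Longrightarrow> i = j \<and> x = y"
  shows "distinct (concat (map (\<lambda>i. map (f i) (ys i)) xs))"
  using assms(1)
proof (induction xs)
  case (Cons i xs)
  have "distinct (map (f i) (ys i))"
    using assms(2,3) by (auto simp: distinct_map inj_on_def)
  then show ?case using Cons assms(3) by fastforce
qed simp

lemma distinct_row_index: "distinct (row_index r n)"
  unfolding row_index_def by (rule distinct_concat_map) auto

lemma distinct_column_index: "distinct (column_index n K)"
  unfolding column_index_def by (rule distinct_concat_map) auto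

section \<open>Rankings and characteristic sets\<close>

lemma rankingD:
  assumes "ranking n lt"
  shows "irreflp_on ({1..n} \<times> UNIV) lt" "transp_on ({1..n} \<times> UNIV) lt" "totalp_on ({1..n} \<times> UNIV) lt"
    "\<And>v. v \<in> {1..n} \<times> UNIV \<Longrightarrow> lt v (dnext v)"
  using assms by (auto simp: ranking_def Let_def)

lemma ranking_irrefl: "ranking n lt \<Longrightarrow> v \<in> {1..n} \<times> UNIV \<Longrightarrow> \<not> lt v v"
  by (rule irreflp_onD[OF rankingD(1)])

lemma ranking_trans:
  "ranking n lt \<Longrightarrow> u \<in> {1..n} \<times> UNIV \<Longrightarrow> v \<in> {1..n} \<times> UNIV \<Longrightarrow> w \<in> {1..n} \<times> UNIV \<Longrightarrow>
    lt u v \<Longrightarrow> lt v w \<Longrightarrow> lt u w"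
  by (rule transp_onD[OF rankingD(2)])

lemma ranking_total:
  "ranking n lt \<Longrightarrow> u \<in> {1..n} \<times> UNIV \<Longrightarrow> v \<in> {1..n} \<times> UNIV \<Longrightarrow> u \<noteq> v \<Longrightarrow> lt u v \<or> lt v u"
  by (rule totalp_onD[OF rankingD(3)])

lemma dnext_pow: "(dnext ^^ k) v = (fst v, snd v + k)"
  by (induction k) (simp_all add: dnext_def)

lemma ranking_dnext_pow:
  assumes lt: "ranking n lt" and i: "i \<in> {1..n}" and "k < l"
  shows "lt (i, k) (i, l)"
  using assms(3)
proof (induction l)
  case (Suc l)
  have step: "lt (i, l) (i, Suc l)" using rankingD(4)[OF lt, of "(i, l)"] i by (simp add: dnext_def)
  show ?case
  proof (cases "k = l")
    case False
    then have "lt (i, k) (i, l)" using Suc by simp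
    then show ?thesis using ranking_trans[OF lt _ _ _ _ step] i by auto
  qed (use step in simp)
qed simp

lemma ranking_exists: "\<exists>lt. ranking n lt"
proof
  show "ranking n (\<lambda>v w. snd v < snd w \<or> (snd v = snd w \<and> fst v < fst w))"
    unfolding ranking_def Let_def irreflp_on_def transp_on_def totalp_on_def dnext_def by auto
qed

lemma ranking_max_exists:
  assumes lt: "ranking n lt" and "finite S" "S \<noteq> {}" "S \<subseteq> {1..n} \<times> UNIV"
  shows "\<exists>v\<in>S. \<forall>w\<in>S. w \<noteq> v \<longrightarrow> lt w v"
  using assms(2-4)
proof (induction S rule: finite_ne_induct)
  case (insert u S)
  then obtain v where v: "v \<in> S" "\<forall>w\<in>S. w \<noteq> v \<longrightarrow> lt w v" by auto
  have V: "u \<in> {1..n} \<times> UNIV" "S \<subseteq> {1..n} \<times> UNIV" using insert.prems by auto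
  have "u \<noteq> v" using v insert.hyps by auto
  then consider "lt u v" | "lt v u" using ranking_total[OF lt V(1)] V(2) v(1) by blast
  then show ?case
  proof cases
    case 1
    then show ?thesis using v by blast
  next
    case 2
    have "lt w u" if "w \<in> S" for w
      using that v 2 ranking_trans[OF lt _ _ V(1), of w v] V(2) by (cases "w = v") blast+
    then show ?thesis by blast
  qed
qed simp

lemma dvars_eq_empty_iff: "dvars p = {} \<longleftrightarrow> p \<in> range dconst"
proof
  assume "dvars p = {}"
  then have keys: "Poly_Mapping.keys p \<subseteq> {0}"
    by (auto simp: dvars_def)
  have "p = dconst (Poly_Mapping.lookup p 0)"
    using keys by (intro poly_mapping_eqI) (auto simp: dconst_def lookup_single when_def in_keys_iff)
  then show "p \<in> range dconst" by blast
qed (auto simp: dvars_def dconst_def split: if_splits)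

lemma leader_max:
  assumes lt: "ranking n lt" and p: "p \<in> dring {1..n}" "p \<notin> range dconst"
  shows "leader lt p \<in> dvars p" "\<And>w. w \<in> dvars p \<Longrightarrow> w \<noteq> leader lt p \<Longrightarrow> lt w (leader lt p)"
proof -
  have S: "dvars p \<noteq> {}" "dvars p \<subseteq> {1..n} \<times> UNIV"
    using p by (simp_all add: dvars_eq_empty_iff dring_def)
  obtain v where v: "v \<in> dvars p" "\<forall>w\<in>dvars p. w \<noteq> v \<longrightarrow> lt w v"
    using ranking_max_exists[OF lt finite_dvars S] by blast
  have "leader lt p = v"
    unfolding leader_def
  proof (rule the_equality)
    fix u assume u: "u \<in> dvars p \<and> (\<forall>w\<in>dvars p. w \<noteq> u \<longrightarrow> lt w u)"
    show "u = v"
    proof (rule ccontr)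
      assume "u \<noteq> v"
      then have "lt u v" "lt v u" using u v by auto
      then have "lt v v" using ranking_trans[OF lt, of v u v] u v S(2) by blast
      then show False using ranking_irrefl[OF lt, of v] v S(2) by blast
    qed
  qed (use v in blast)
  then show "leader lt p \<in> dvars p" "\<And>w. w \<in> dvars p \<Longrightarrow> w \<noteq> leader lt p \<Longrightarrow> lt w (leader lt p)"
    using v by auto
qed

lemma var_degree_eq_0_iff: "var_degree v p = 0 \<longleftrightarrow> v \<notin> dvars p"
proof -
  have "var_degree v p = 0 \<longleftrightarrow> (\<forall>m\<in>Poly_Mapping.keys p. Poly_Mapping.lookup m v = 0)"
    unfolding var_degree_def by (subst Max_eq_iff) auto
  then show ?thesis by (auto simp: dvars_def in_keys_iff)
qed

lemma var_degree_affine: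
  assumes p: "is_affine p c f" and v: "f v \<noteq> 0"
  shows "var_degree v p = 1"
proof -
  have "Poly_Mapping.lookup m v \<le> 1" if "m \<in> Poly_Mapping.keys p" for m
  proof (cases "m = 0")
    case False
    then have "m \<in> range vmon" using p that unfolding is_affine_def in_keys_iff by blast
    then show ?thesis by (auto simp: vmon_def lookup_single when_def)
  qed simp
  then have "var_degree v p \<le> 1" by (auto simp: var_degree_def)
  moreover have "var_degree v p \<noteq> 0"
    using v by (simp add: var_degree_eq_0_iff is_affine_dvars[OF p])
  ultimately show ?thesis by simp
qed

lemma reduced_wrt_leader_degree_1:
  assumes "leader_degree lt f = 1" "reduced_wrt lt g f"
  shows "(dnext ^^ k) (leader lt f) \<notin> dvars g"
  using assms by (cases k) (auto simp: reduced_wrt_def var_degree_eq_0_iff[symmetric])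

text \<open>
If the leader of \<open>A\<close> has degree one, an element of \<open>I\<close> that is of lower rank than \<open>A\<close>, or reduced
with respect to a polynomial of the same rank as \<open>A\<close>, contains neither that leader nor a
derivative of it, so it is 0 by hypothesis.  So no autoreduced list in \<open>I\<close> starts below \<open>A\<close>, and one that starts at the
rank of \<open>A\<close> ends there.
\<close>

lemma characteristic_set_principal:
  assumes A: "A \<in> I" "A \<in> dring {1..n} - range dconst"
    and deg: "leader_degree lt A = 1" and lt: "ranking n lt"
    and sep: "\<And>g. g \<in> I \<Longrightarrow> g \<in> dring {1..n} \<Longrightarrow> \<forall>k. (dnext ^^ k) (leader lt A) \<notin> dvars g \<Longrightarrow> g = 0"
  shows "characteristic_set n lt I {A}"
    and "characteristic_set n lt I C \<Longrightarrow> card C = 1"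
proof -
  let ?v = "leader lt A"
  have v: "?v \<in> {1..n} \<times> UNIV" using leader_max(1)[OF lt, of A] A by (auto simp: dring_def)
  have zero_const: "(0 :: 'a dpoly) \<in> range dconst" by (metis dconst_0 rangeI)
  have no_reduced: "\<not> reduced_wrt lt g f"
    if "g \<in> I" "g \<in> dring {1..n} - range dconst" "rank_eq lt f A" for f g
    using sep[of g] reduced_wrt_leader_degree_1[of lt f g] that deg zero_const
    by (auto simp: rank_eq_def)
  have not_lower: "\<not> rank_less lt g A" if g: "g \<in> I" "g \<in> dring {1..n} - range dconst" for g
  proof
    assume less: "rank_less lt g A"
    have lg: "leader lt g \<in> dvars g" "\<And>w. w \<in> dvars g \<Longrightarrow> w \<noteq> leader lt g \<Longrightarrow> lt w (leader lt g)"
      using leader_max[OF lt, of g] g by auto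
    then have "leader_degree lt g \<noteq> 0"
      by (simp add: leader_degree_def var_degree_eq_0_iff)
    then have l: "lt (leader lt g) ?v" using less deg by (auto simp: rank_less_def)
    have gV: "dvars g \<subseteq> {1..n} \<times> UNIV" using g by (simp add: dring_def)
    have below: "lt w ?v" if "w \<in> dvars g" for w
      using ranking_trans[OF lt _ _ v _ l, of w] lg l that gV by (cases "w = leader lt g") blast+
    have "(dnext ^^ k) ?v \<notin> dvars g" for k
    proof
      assume w: "(dnext ^^ k) ?v \<in> dvars g"
      then have less: "lt ((dnext ^^ k) ?v) ?v" by (rule below)
      have "k \<noteq> 0" using less ranking_irrefl[OF lt v] by (cases k) auto
      then have "lt ?v ((dnext ^^ k) ?v)"
        using ranking_dnext_pow[OF lt, of "fst ?v" "snd ?v" "snd ?v + k"] v by (simp add: dnext_pow mem_Times_iff)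
      then show False
        using ranking_trans[OF lt v _ v _ less] ranking_irrefl[OF lt v] w gV by blast
    qed
    then have "g = 0" using sep g by blast
    then show False using g zero_const by blast
  qed
  have listA: "autoreduced_list n lt [A]" using A(2) by (simp add: autoreduced_list_def autoreduced_def)
  have memb: "c \<in> I" "c \<in> dring {1..n} - range dconst"
    if "autoreduced_list n lt cs" "set cs \<subseteq> I" "c \<in> set cs" for c cs
    using that by (auto simp: autoreduced_list_def autoreduced_def)
  have no_second: False
    if cs: "autoreduced_list n lt cs" "set cs \<subseteq> I" and len: "Suc 0 < length cs" and eq: "rank_eq lt (cs ! 0) A"
    for cs
  proof -
    have less: "rank_less lt (cs ! 0) (cs ! 1)"
      using cs(1) len by (auto simp: autoreduced_list_def sorted_wrt_iff_nth_less)
    have mem: "cs ! 0 \<in> set cs" "cs ! 1 \<in> set cs" using len by (auto intro: nth_mem)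
    have "\<not> lt ?v ?v" using v by (rule ranking_irrefl[OF lt])
    then have "cs ! 0 \<noteq> cs ! 1" using less eq by (auto simp: rank_less_def rank_eq_def)
    then have "reduced_wrt lt (cs ! 1) (cs ! 0)"
      using cs(1) mem by (auto simp: autoreduced_list_def autoreduced_def)
    then show False using no_reduced[OF memb[OF cs mem(2)] eq] by blast
  qed
  show "characteristic_set n lt I {A}"
    unfolding characteristic_set_def
  proof (intro exI conjI)
    show "set [A] = {A}" "autoreduced_list n lt [A]" "{A} \<subseteq> I" using A listA by auto
    show "\<not> (\<exists>bs. autoreduced_list n lt bs \<and> set bs \<subseteq> I \<and> lower_list lt bs [A])"
    proof (rule notI, elim exE conjE)
      fix bs assume bs: "autoreduced_list n lt bs" "set bs \<subseteq> I" and low: "lower_list lt bs [A]"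
      from low consider "0 < length bs" "rank_less lt (bs ! 0) A"
        | "Suc 0 < length bs" "rank_eq lt (bs ! 0) A"
        by (auto simp: lower_list_def)
      then show False
      proof cases
        case 1
        then show False using not_lower[OF memb[OF bs, of "bs ! 0"]] by (simp add: nth_mem)
      next
        case 2
        then show False using no_second[OF bs] by blast
      qed
    qed
  qed
  assume "characteristic_set n lt I C"
  then obtain cs where cs: "set cs = C" "autoreduced_list n lt cs" "set cs \<subseteq> I"
    and min: "\<And>bs. autoreduced_list n lt bs \<Longrightarrow> set bs \<subseteq> I \<Longrightarrow> \<not> lower_list lt bs cs"
    unfolding characteristic_set_def by blast
  have nl: "\<not> lower_list lt [A] cs" using min[OF listA] A(1) by simp
  then have ne: "0 < length cs" by (cases cs) (auto simp: lower_list_def)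
  then have c0: "cs ! 0 \<in> I" "cs ! 0 \<in> dring {1..n} - range dconst" using memb[OF cs(2,3)] by auto
  have "\<not> rank_less lt A (cs ! 0)" using nl ne by (auto simp: lower_list_def)
  moreover have "\<not> rank_less lt (cs ! 0) A" using not_lower[OF c0] .
  moreover have "leader lt (cs ! 0) \<in> {1..n} \<times> UNIV"
    using leader_max(1)[OF lt, of "cs ! 0"] c0 by (auto simp: dring_def)
  ultimately have "rank_eq lt (cs ! 0) A"
    using ranking_total[OF lt v, of "leader lt (cs ! 0)"]
    unfolding rank_less_def rank_eq_def by (metis linorder_neqE_nat)
  then have "length cs = 1" using no_second[OF cs(2,3)] ne by (metis One_nat_def Suc_lessI)
  then obtain c where "cs = [c]" by (auto simp: length_Suc_conv)
  then show "card C = 1" using cs(1) by auto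
qed

section \<open>The resultant\<close>

text \<open>
The cofactors along the last column are a relation of window 1: they annihilate the forms in the
columns of the matrix, and in all other columns the forms of window 1 are zero.  They are not all 0,
because the determinant is nonzero for the border \<open>e\<close> that makes the columns independent.
\<close>

lemma (in regular_linear_forms) bordered_det_relation:
  assumes rs: "distinct rs" "set rs = window 1"
    and cs: "distinct cs" "set cs = {1..n-1} \<times> {..<Suc N}"
    and len: "length rs = Suc (length cs)"
    and H: "comm_ring_hom (H :: 'a \<Rightarrow> 'b::comm_ring_1)"
  obtains c w0 where "relation 1 c" "c w0 \<noteq> 0"
    "\<And>x. det (mat (Suc (length cs)) (Suc (length cs))
        (\<lambda>(i, j). if j < length cs then H (form (rs ! i) (cs ! j)) else x (rs ! i)))
      = (\<Sum>w\<in>window 1. H (c w) * x w)"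
proof -
  let ?k = "length cs"
  obtain g where g: "\<And>v. v \<in> set cs \<Longrightarrow> (\<Sum>w\<in>set rs. g w * form w v) = 0"
    "\<And>x. det (mat (Suc ?k) (Suc ?k) (\<lambda>(i, j). if j < ?k then form (rs ! i) (cs ! j) else x (rs ! i)))
       = (\<Sum>w\<in>set rs. g w * x w)"
    "\<And>x. det (mat (Suc ?k) (Suc ?k) (\<lambda>(i, j). if j < ?k then H (form (rs ! i) (cs ! j)) else x (rs ! i)))
       = (\<Sum>w\<in>set rs. H (g w) * x w)"
    using det_bordered_expansion[OF rs(1) cs(1) len H, of form] by blast
  define c where "c w = (if w \<in> window 1 then g w else 0)" for w
  have "relation 1 c"
  proof (rule relationI)
    fix v
    have gc: "(\<Sum>w\<in>window 1. c w * form w v) = (\<Sum>w\<in>window 1. g w * form w v)"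
      by (intro sum.cong) (auto simp: c_def)
    show "(\<Sum>w\<in>window 1. c w * form w v) = 0"
    proof (cases "v \<in> set cs")
      case True
      then show ?thesis using g(1) rs(2) gc by simp
    next
      case False
      have "form w v = 0" if w: "w \<in> window 1" for w
      proof (rule ccontr)
        assume nz: "form w v \<noteq> 0"
        obtain i k where ik: "w = (i, k)" "i \<in> {1..n}" "k < N - ord i + 1"
          using w unfolding window_def by blast
        obtain j l where "v = (j, l)" by force
        then have "v \<in> set cs"
          using form_support[OF ik(2), of k j l] nz ik ord_le[OF ik(2)] cs(2) by auto
        with False show False by blast
      qed
      then show ?thesis by simp
    qed
  qed (simp add: c_def)
  moreover have "\<exists>w0. c w0 \<noteq> 0"
  proof -
    obtain e where e: "\<And>y s. \<forall>w\<in>window 1. (\<Sum>v\<in>{1..n-1} \<times> {..<Suc N}. form w v * y v) + e w * s = 0 \<Longrightarrow>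
         s = 0 \<and> (\<forall>v\<in>{1..n-1} \<times> {..<Suc N}. y v = 0)"
      using bordered_columns_independent by blast
    define cs' where "cs' = map Some cs @ [None]"
    define f where "f w c = (case c of Some v \<Rightarrow> form w v | None \<Rightarrow> e w)" for w c
    have cs': "distinct cs'" "length rs = length cs'" "set cs' = insert None (Some ` set cs)"
      using cs(1) len by (auto simp: cs'_def distinct_map)
    have "det (mat (length rs) (length cs') (\<lambda>(i, j). f (rs ! i) (cs' ! j))) \<noteq> 0"
      unfolding det_nonzero_iff_columns_independent[OF rs(1) cs'(1,2)]
    proof (intro allI impI)
      fix y assume y: "\<forall>r\<in>set rs. (\<Sum>c\<in>set cs'. f r c * y c) = 0"
      have "(\<Sum>c\<in>set cs'. f w c * y c) = (\<Sum>v\<in>set cs. form w v * y (Some v)) + e w * y None" for w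
        by (simp add: cs'(3) f_def sum.reindex add.commute)
      with y have "\<forall>w\<in>window 1. (\<Sum>v\<in>{1..n-1} \<times> {..<Suc N}. form w v * y (Some v)) + e w * y None = 0"
        unfolding rs(2) cs(2) by simp
      from e[of "\<lambda>v. y (Some v)" "y None", OF this] show "\<forall>c\<in>set cs'. y c = 0"
        unfolding cs'(3) cs(2) by blast
    qed
    also have "mat (length rs) (length cs') (\<lambda>(i, j). f (rs ! i) (cs' ! j))
      = mat (Suc ?k) (Suc ?k) (\<lambda>(i, j). if j < ?k then form (rs ! i) (cs ! j) else e (rs ! i))"
      using len by (intro eq_matI) (auto simp: cs'_def f_def nth_append)
    finally have "(\<Sum>w\<in>window 1. g w * e w) \<noteq> 0" by (simp add: g(2) rs(2))
    then obtain w where "w \<in> window 1" "g w * e w \<noteq> 0"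
      by (rule sum.not_neutral_contains_not_neutral)
    then have "c w \<noteq> 0" by (simp add: c_def)
    then show ?thesis by blast
  qed
  then obtain w0 where "c w0 \<noteq> 0" by blast
  moreover have "det (mat (Suc ?k) (Suc ?k) (\<lambda>(i, j). if j < ?k then H (form (rs ! i) (cs ! j)) else x (rs ! i)))
      = (\<Sum>w\<in>window 1. H (c w) * x w)" for x
    unfolding g(3) rs(2) by (intro sum.cong) (auto simp: c_def)
  ultimately show thesis by (rule that)
qed

lemma coeff_matrix_eq_mat:
  "coeff_matrix ms (map f rs) = mat (length rs) (length ms) (\<lambda>(i, j). Poly_Mapping.lookup (f (rs ! i)) (ms ! j))"
  by (intro eq_matI) (auto simp: coeff_matrix_def mat_of_rows_list_def)

lemma u_columns_eq_column_index: "u_columns n K = map vmon (column_index n K)"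
  by (simp add: u_columns_def column_index_def map_concat comp_def)

lemma deriv_blocks_eq_row_index:
  "concat (map (\<lambda>i. deriv_block D (r i) (F i)) [1..<n+1])
    = map (\<lambda>w. (dderiv D ^^ snd w) (F (fst w))) (row_index r n)"
  by (simp add: deriv_block_def row_index_def map_concat comp_def)

lemma hom_res_matrix_eq:
  fixes d :: "'a::comm_ring_1 \<Rightarrow> 'a" and L :: "nat \<Rightarrow> nat \<Rightarrow> 'a poly" and n :: nat
  assumes d: "derivation d"
  defines "rs \<equiv> row_index (\<lambda>i. order_sum n (dppe_H d n L) - dorder (dppe_H d n L i)) n"
    and "cs \<equiv> column_index n (order_sum n (dppe_H d n L))"
  shows "hom_res_matrix d n (dppe_H d n L) = mat (length rs) (length cs)
    (\<lambda>(i, j). (form_deriv d ^^ snd (rs ! i)) (dppe_form n L (fst (rs ! i))) (cs ! j))"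
proof -
  have "Poly_Mapping.lookup ((dderiv d ^^ k) (dppe_H d n L i)) (vmon v) = (form_deriv d ^^ k) (dppe_form n L i) v"
    for k i v
    using is_affine_lookup(2)[OF is_affine_dderiv_pow[OF derivation_additive[OF d] is_affine_dppe_H[OF d]]] .
  then show ?thesis
    unfolding hom_res_matrix_def Let_def u_columns_eq_column_index deriv_blocks_eq_row_index
      coeff_matrix_eq_mat rs_def[symmetric] cs_def[symmetric]
    by (intro eq_matI) auto
qed

lemma res_matrix_eq:
  fixes d :: "'a::comm_ring_1 \<Rightarrow> 'a" and L :: "nat \<Rightarrow> nat \<Rightarrow> 'a poly" and n :: nat
  assumes d: "derivation d"
  defines "rs \<equiv> row_index (\<lambda>i. order_sum n (dppe_H d n L) - dorder (dppe_H d n L i) + 1) n"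
    and "cs \<equiv> column_index n (Suc (order_sum n (dppe_H d n L)))"
  shows "res_matrix (dderiv d) n (dppe_F d n a L) = mat (length rs) (Suc (length cs))
    (\<lambda>(i, j). if j < length cs
       then dconst ((form_deriv d ^^ snd (rs ! i)) (dppe_form n L (fst (rs ! i))) (cs ! j))
       else dvariable (rs ! i) - dconst ((d ^^ snd (rs ! i)) (a (fst (rs ! i)))))"
proof -
  have os: "order_sum n (dppe_F d n a L) = order_sum n (dppe_H d n L)"
    by (simp add: order_sum_def dorder_dppe_F[OF d])
  have "Poly_Mapping.lookup ((dderiv (dderiv d) ^^ k) (dppe_F d n a L i)) (vmon v)
      = dconst ((form_deriv d ^^ k) (dppe_form n L i) v)"
    "Poly_Mapping.lookup ((dderiv (dderiv d) ^^ k) (dppe_F d n a L i)) 0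
      = dvariable (i, k) - dconst ((d ^^ k) (a i))" for k i v
    using is_affine_lookup[OF is_affine_deriv_dppe_F[OF d, of k n a L i]] by simp_all
  then show ?thesis
    unfolding res_matrix_def Let_def os dorder_dppe_F[OF d] u_columns_eq_column_index deriv_blocks_eq_row_index
      coeff_matrix_eq_mat rs_def[symmetric] Suc_eq_plus1[symmetric, of "order_sum n (dppe_H d n L)"]
      cs_def[symmetric]
    by (intro eq_matI) (auto simp: nth_append less_Suc_eq)
qed

lemma dppe_form_support:
  assumes d: "derivation d" and nz: "dppe_form n L i (j, k) \<noteq> 0"
  shows "j \<in> {1..n-1} \<and> k \<le> dorder (dppe_H d n L i)"
proof
  show "j \<in> {1..n-1}" using nz by (auto simp: dppe_form_def split: if_splits)
  have "k \<in> snd ` {v. dppe_form n L i v \<noteq> 0}" using nz by force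
  moreover have "dorder (dppe_H d n L i) = Max (snd ` {v. dppe_form n L i v \<noteq> 0})"
    using nz dorder_affine[OF is_affine_dppe_H[OF d]] by auto
  ultimately show "k \<le> dorder (dppe_H d n L i)"
    using is_affine_finite[OF is_affine_dppe_H[OF d, of n L i]] by (simp add: Max_ge)
qed

text \<open>
Injectivity of the symbol: for \<open>N \<ge> 1\<close> a vector \<open>y\<close> in its kernel, placed in the columns of order
\<open>N - 1\<close>, is annihilated by the homogeneous matrix, whose entries in these columns are zero or
coefficients of the symbol.  For \<open>N = 0\<close> the matrix is empty; then \<open>n = 2\<close>, the symbol is a
single column, and it is nonzero because \<open>u\<^sub>1\<close> occurs in some \<open>H\<^sub>i\<close>.
\<close>

lemma regular_linear_forms_dppe:
  assumes d: "derivation d" and n: "n \<ge> 2"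
    and nz: "\<forall>j\<in>{1..n-1}. \<exists>i\<in>{1..n}. L i j \<noteq> 0"
    and N: "n = 2 \<or> order_sum n (dppe_H d n L) \<ge> 1"
    and res: "diff_hom_res d n (dppe_H d n L) \<noteq> 0"
  shows "regular_linear_forms d n (dppe_form n L) (\<lambda>i. dorder (dppe_H d n L i)) (order_sum n (dppe_H d n L))"
proof -
  define N where "N = order_sum n (dppe_H d n L)"
  define ord where "ord i = dorder (dppe_H d n L i)" for i
  define h where "h = dppe_form n L"
  define form where "form w v = (form_deriv d ^^ snd w) (h (fst w)) v" for w v
  let ?R = "SIGMA i:{1..n}. {..<N - ord i}" and ?C = "{1..n-1} \<times> {..<N}"
  have ord_le: "ord i \<le> N" if "i \<in> {1..n}" for i
    unfolding ord_def N_def using that by (rule dorder_le_order_sum)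
  have supp: "j \<in> {1..n-1} \<and> k \<le> ord i" if "h i (j, k) \<noteq> 0" for i j k
    using dppe_form_support[OF d] that unfolding h_def ord_def by blast
  let ?rs = "row_index (\<lambda>i. N - ord i) n" and ?cs = "column_index n N"
  have mat: "hom_res_matrix d n (dppe_H d n L)
      = mat (length ?rs) (length ?cs) (\<lambda>(i, j). form (?rs ! i) (?cs ! j))"
    using hom_res_matrix_eq[OF d, of n L] by (simp add: N_def ord_def h_def form_def)
  have len: "length ?rs = length ?cs"
    using hom_res_matrix_carrier[of n d "dppe_H d n L"] n unfolding mat carrier_mat_def by simp
  have det: "det (mat (length ?rs) (length ?cs) (\<lambda>(i, j). form (?rs ! i) (?cs ! j))) \<noteq> 0"
    using res by (simp add: diff_hom_res_def mat)
  have rows: "\<forall>w\<in>?R. b w = 0" if "\<forall>v\<in>?C. (\<Sum>w\<in>?R. b w * form w v) = 0" for b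
    using det[unfolded det_nonzero_iff_rows_independent[OF distinct_row_index distinct_column_index len]] that
    unfolding set_row_index set_column_index by blast
  have columns: "\<forall>v\<in>?C. y v = 0" if "\<forall>w\<in>?R. (\<Sum>v\<in>?C. form w v * y v) = 0" for y
    using det[unfolded det_nonzero_iff_columns_independent[OF distinct_row_index distinct_column_index len]] that
    unfolding set_row_index set_column_index by blast
  have symbol: "\<forall>j\<in>{1..n-1}. y j = 0" if y: "\<forall>i\<in>{1..n}. (\<Sum>j\<in>{1..n-1}. h i (j, ord i) * y j) = 0" for y
  proof (cases "N = 0")
    case True
    then have n2: "n = 2" using N by (simp add: N_def)
    then obtain i where i: "i \<in> {1..n}" "L i 1 \<noteq> 0" using nz by auto
    have oi: "ord i = 0" using ord_le[OF i(1)] True by simp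
    have "h i (1, degree (L i 1)) \<noteq> 0" using i(2) n2 by (simp add: h_def dppe_form_def)
    moreover from this have "degree (L i 1) = 0" using supp oi by fastforce
    ultimately have "h i (1, ord i) \<noteq> 0" by (simp add: oi)
    moreover have "h i (1, ord i) * y 1 = 0" using y i(1) n2 by auto
    ultimately show ?thesis using n2 by auto
  next
    case False
    define Y where "Y v = (if snd v = N - 1 then y (fst v) else 0)" for v :: dvar
    have "(\<Sum>v\<in>?C. form w v * Y v) = 0" if wR: "w \<in> ?R" for w
    proof -
      obtain i k where w: "w = (i, k)" and i: "i \<in> {1..n}" and k: "k < N - ord i" using wR by blast
      have "(\<Sum>v\<in>?C. form w v * Y v) = (\<Sum>j\<in>{1..n-1}. \<Sum>l<N. if l = N - 1 then form w (j, N - 1) * y j else 0)"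
        unfolding sum.cartesian_product' by (intro sum.cong refl) (auto simp: Y_def)
      also have "\<dots> = (\<Sum>j\<in>{1..n-1}. form w (j, N - 1) * y j)" using False by simp
      also have "\<dots> = 0"
      proof -
        have top: "(\<forall>l > ord i + k. form w (j, l) = 0) \<and> form w (j, ord i + k) = h i (j, ord i)" for j
          using form_deriv_pow_top[of d "ord i" "h i" j k, OF d] supp[of i j] w
          by (auto simp: form_def not_le[symmetric])
        show ?thesis
        proof (cases "ord i + k = N - 1")
          case True
          then show ?thesis using top y i by simp
        next
          case False
          then have "N - 1 > ord i + k" using k by simp
          then show ?thesis using top by simp
        qed
      qed
      finally show ?thesis .
    qed
    then have "\<forall>v\<in>?C. Y v = 0" using columns[of Y] by blast
    then have "Y (j, N - 1) = 0" if "j \<in> {1..n-1}" for j using that False by auto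
    then show ?thesis by (simp add: Y_def)
  qed
  show ?thesis
    unfolding N_def[symmetric] ord_def[symmetric] h_def[symmetric]
  proof unfold_locales
    show "derivation d" by (rule d)
    show "1 \<le> n" using n by simp
    show "i \<in> {1..n} \<Longrightarrow> ord i \<le> N" for i by (rule ord_le)
    show "h i (j, k) \<noteq> 0 \<Longrightarrow> j \<in> {1..n-1} \<and> k \<le> ord i" for i j k by (rule supp)
    show "\<forall>w\<in>?R. b w = 0"
      if "\<forall>v\<in>?C. (\<Sum>w\<in>?R. b w * (form_deriv d ^^ snd w) (h (fst w)) v) = 0" for b
      by (rule rows) (use that in \<open>simp only: form_def\<close>)
    show "\<forall>v\<in>?C. y v = 0"
      if "\<forall>w\<in>?R. (\<Sum>v\<in>?C. (form_deriv d ^^ snd w) (h (fst w)) v * y v) = 0" for y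
      by (rule columns) (use that in \<open>simp only: form_def\<close>)
    show "\<forall>i\<in>{1..n}. (\<Sum>j\<in>{1..n-1}. h i (j, ord i) * y j) = 0 \<Longrightarrow> \<forall>j\<in>{1..n-1}. y j = 0" for y
      by (rule symbol)
  qed
qed

theorem theorem4p3:
  fixes d :: "'a::field \<Rightarrow> 'a"
    and n :: nat
    and P :: "nat \<Rightarrow> 'a dpoly"
    and a :: "nat \<Rightarrow> 'a"
    and L :: "nat \<Rightarrow> nat \<Rightarrow> 'a poly"
  assumes "derivation d"
    and "n \<ge> 2"
    and "\<forall>i\<in>{1..n}. P i \<in> dring {1..n-1} \<and> total_degree_le 1 (P i)"
    and "\<exists>i\<in>{1..n}. P i \<notin> range dconst"
    and "\<forall>i\<in>{1..n}. P i = dconst (a i) - (\<Sum>j\<in>{1..n-1}. dop_apply d (L i j) (dvariable (j, 0)))"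
    and "\<forall>j\<in>{1..n-1}. \<exists>i\<in>{1..n}. L i j \<noteq> 0"
    and "n = 2 \<or> order_sum n (dppe_H d n L) \<ge> 1"
    and "diff_hom_res d n (dppe_H d n L) \<noteq> 0"
  shows "has_diff_dimension n (implicit_ideal d n P) (n - 1) \<and>
    characteristic_polynomial n (implicit_ideal d n P)
      (diff_res (dderiv d) n (dppe_F d n a L))"
proof -
  define N where "N = order_sum n (dppe_H d n L)"
  define ord where "ord i = dorder (dppe_H d n L i)" for i
  define h where "h = dppe_form n L"
  define \<alpha> where "\<alpha> w = (d ^^ snd w) (a (fst w))" for w :: dvar
  define g where "g w = (dderiv d ^^ snd w) (P (fst w))" for w :: dvar
  define A where "A = diff_res (dderiv d) n (dppe_F d n a L)"
  note d = assms(1)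
  note add = derivation_additive[OF d]
  interpret regular_linear_forms d n h ord N
    unfolding h_def ord_def N_def
    by (rule regular_linear_forms_dppe[OF assms(1,2,6-8)])
  interpret dc: comm_ring_hom "dconst :: 'a \<Rightarrow> 'a dpoly" by (rule comm_ring_hom_dconst)
  let ?rs = "row_index (\<lambda>i. N - ord i + 1) n" and ?cs = "column_index n (Suc N)"
  have mat: "res_matrix (dderiv d) n (dppe_F d n a L) = mat (length ?rs) (Suc (length ?cs))
      (\<lambda>(i, j). if j < length ?cs then dconst (form (?rs ! i) (?cs ! j))
         else dvariable (?rs ! i) - dconst (\<alpha> (?rs ! i)))"
    unfolding form_def unfolding N_def ord_def h_def \<alpha>_def by (rule res_matrix_eq[OF d])
  have len: "length ?rs = Suc (length ?cs)"
    using res_matrix_carrier[of n "dderiv d" "dppe_F d n a L"] n unfolding mat carrier_mat_def by simp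
  have set_rs: "set ?rs = window 1" by (simp add: set_row_index window_def)
  obtain c w0 where c: "relation 1 c" and w0: "c w0 \<noteq> 0"
    and det: "\<And>x. det (mat (Suc (length ?cs)) (Suc (length ?cs))
        (\<lambda>(i, j). if j < length ?cs then dconst (form (?rs ! i) (?cs ! j)) else x (?rs ! i)))
      = (\<Sum>w\<in>window 1. dconst (c w) * x w)"
    using bordered_det_relation[OF distinct_row_index set_rs distinct_column_index set_column_index len
        comm_ring_hom_dconst] by blast
  have A: "A = (\<Sum>w\<in>window 1. dconst (c w) * (dvariable w - dconst (\<alpha> w)))"
    unfolding A_def diff_res_def mat len by (rule det)
  have A_affine: "is_affine A (\<Sum>w\<in>window 1. c w * (0 - \<alpha> w)) c"
  proof -
    have "is_affine A (\<Sum>w\<in>window 1. c w * (0 - \<alpha> w))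
       (\<lambda>v. \<Sum>w\<in>window 1. c w * ((if v = w then 1 else 0) - 0))"
      unfolding A
      by (intro is_affine_sum is_affine_scale is_affine_diff is_affine_dvariable is_affine_dconst)
    moreover have "(\<Sum>w\<in>window 1. c w * ((if v = w then 1 else 0) - 0)) = c v" for v
    proof -
      have "(\<Sum>w\<in>window 1. c w * ((if v = w then 1 else 0) - 0)) = (\<Sum>w\<in>window 1. if v = w then c v else 0)"
        by (intro sum.cong) auto
      then show ?thesis using relation_support[OF c, of v] by simp
    qed
    ultimately show ?thesis by simp
  qed
  have A_vars: "dvars A = {v. c v \<noteq> 0}" by (rule is_affine_dvars[OF A_affine])
  have A_ring: "A \<in> dring {1..n} - range dconst"
  proof
    have "window 1 \<subseteq> {1..n} \<times> UNIV" by (auto simp: window_def)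
    then show "A \<in> dring {1..n}" using relation_support[OF c] by (auto simp: dring_def A_vars)
    have "w0 \<in> dvars A" using w0 by (simp add: A_vars)
    then show "A \<notin> range dconst" unfolding dvars_eq_empty_iff[symmetric] by blast
  qed
  have g_affine: "is_affine (g w) (\<alpha> w) (\<lambda>v. 0 - form w v)" if "fst w \<in> {1..n}" for w
  proof -
    have "P (fst w) = dconst (a (fst w)) - dppe_H d n L (fst w)"
      using assms(5) that by (simp add: dppe_H_def)
    then have "g w = dconst (\<alpha> w) - (dderiv d ^^ snd w) (dppe_H d n L (fst w))"
      by (simp add: g_def \<alpha>_def additive.diff[OF additive_pow[OF additive_dderiv[OF add]]]
          dderiv_pow_dconst[OF add])
    moreover have "is_affine ((dderiv d ^^ snd w) (dppe_H d n L (fst w))) 0 (form w)"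
    proof -
      have "(d ^^ k) 0 = 0" for k by (rule additive.zero[OF additive_pow[OF add]])
      then show ?thesis
        using is_affine_dderiv_pow[OF add is_affine_dppe_H[OF d, of n L "fst w"], of "snd w"]
        unfolding form_def unfolding h_def by simp
    qed
    note is_affine_diff[OF is_affine_dconst[of "\<alpha> w"] this]
    ultimately show ?thesis by simp
  qed
  have eval: "dsubst d P = poly_eval dconst g"
    by (simp add: dsubst_eq_poly_eval g_def[abs_def])
  \<comment> \<open>At \<open>g\<close> the polynomial \<open>A\<close> takes the value \<open>- \<Sum> c\<^sub>w \<partial>\<^sup>k H\<^sub>i\<close>, which is 0 by the relation.\<close>
  have "poly_eval dconst g A = (\<Sum>w\<in>window 1. dconst (c w) * (g w - dconst (\<alpha> w)))"
  proof -
    interpret g: comm_ring_hom "poly_eval dconst g" by (rule dc.comm_ring_hom_poly_eval)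
    show ?thesis
      by (simp add: A g.hom_sum g.hom_mult g.hom_minus dc.poly_eval_dconst dc.poly_eval_dvariable_hom)
  qed
  also have "\<dots> = 0"
  proof (rule is_affine_unique)
    have "is_affine (\<Sum>w\<in>window 1. dconst (c w) * (g w - dconst (\<alpha> w)))
       (\<Sum>w\<in>window 1. c w * (\<alpha> w - \<alpha> w)) (\<lambda>v. \<Sum>w\<in>window 1. c w * ((0 - form w v) - 0))"
      by (intro is_affine_sum is_affine_scale is_affine_diff[OF g_affine is_affine_dconst])
        (auto simp: window_def)
    then show "is_affine (\<Sum>w\<in>window 1. dconst (c w) * (g w - dconst (\<alpha> w))) 0 (\<lambda>_. 0)"
      using relation_sum[OF c] by (simp add: sum_negf)
    show "is_affine (0 :: 'a dpoly) 0 (\<lambda>_. 0)" by (simp add: is_affine_def)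
  qed
  finally have A_ideal: "A \<in> implicit_ideal d n P"
    using A_ring by (simp add: implicit_ideal_def eval)
  \<comment> \<open>The derivatives of the \<open>P i\<close> at the variables of \<open>f\<close> are algebraically independent.\<close>
  have sep: "f = 0"
    if lt: "ranking n lt" and f: "f \<in> implicit_ideal d n P" "f \<in> dring {1..n}"
      and avoid: "\<forall>k. (dnext ^^ k) (leader lt A) \<notin> dvars f" for lt f
  proof (rule affine_substitution_injective)
    obtain i0 k0 where l: "leader lt A = (i0, k0)" by force
    have lead: "leader lt A \<in> dvars A" "\<And>w. w \<in> dvars A \<Longrightarrow> w \<noteq> leader lt A \<Longrightarrow> lt w (leader lt A)"
      using leader_max[OF lt, of A] A_ring by auto
    have i0: "i0 \<in> {1..n}" using lead(1) A_ring by (auto simp: l dring_def)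
    have fW: "dvars f \<subseteq> {1..n} \<times> UNIV" using f(2) by (simp add: dring_def)
    show "is_affine (g w) (\<alpha> w) (\<lambda>v. 0 - form w v)" if "w \<in> dvars f" for w
      using g_affine that fW by auto
    show "poly_eval dconst g f = 0" using f(1) by (simp add: implicit_ideal_def eval)
    fix b assume b: "\<forall>v. (\<Sum>w\<in>dvars f. b w * (0 - form w v)) = 0"
    show "\<forall>w\<in>dvars f. b w = 0"
    proof (rule forms_independent[OF c, of i0 k0])
      show "c (i0, k0) \<noteq> 0" using lead(1) by (simp add: l A_vars)
      show "c (i0, k) = 0" if "k > k0" for k
      proof (rule ccontr)
        \<comment> \<open>A higher derivative of \<open>i0\<close> in \<open>A\<close> would outrank the leader.\<close>
        assume "c (i0, k) \<noteq> 0"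
        then have "lt (i0, k) (i0, k0)" using lead(2)[of "(i0, k)"] that by (simp add: l A_vars)
        moreover have "lt (i0, k0) (i0, k)" by (rule ranking_dnext_pow[OF lt i0 that])
        ultimately show False
          using ranking_trans[OF lt, of "(i0, k)" "(i0, k0)" "(i0, k)"] ranking_irrefl[OF lt, of "(i0, k)"] i0
          by simp
      qed
      show "(i0, k) \<notin> dvars f" if "k \<ge> k0" for k
        using avoid[rule_format, of "k - k0"] that by (simp add: l dnext_pow)
      show "(\<Sum>w\<in>dvars f. b w * form w v) = 0" for v
        using b[rule_format, of v] by (simp add: sum_negf)
    qed (use fW in simp_all)
  qed
  have deg: "leader_degree lt A = 1" if lt: "ranking n lt" for lt
    unfolding leader_degree_def
    by (rule var_degree_affine[OF A_affine]) (use leader_max(1)[OF lt, of A] A_ring in \<open>simp add: A_vars\<close>)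
  have cs: "characteristic_set n lt (implicit_ideal d n P) {A}" if lt: "ranking n lt" for lt
    by (rule characteristic_set_principal(1)[OF A_ideal A_ring deg[OF lt] lt sep[OF lt]])
  have card: "card C = 1" if lt: "ranking n lt" and C: "characteristic_set n lt (implicit_ideal d n P) C"
    for lt C
    by (rule characteristic_set_principal(2)[OF A_ideal A_ring deg[OF lt] lt sep[OF lt] C])
  have "has_diff_dimension n (implicit_ideal d n P) (n - 1)"
    unfolding has_diff_dimension_def using cs card ranking_exists[of n] by fastforce
  moreover have "characteristic_polynomial n (implicit_ideal d n P) A"
    unfolding characteristic_polynomial_def
    using A_ring affine_irreducible[OF A_affine w0] cs by blast
  ultimately show ?thesis by (simp add: A_def)
qed

end
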